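(* Let $T=\bigcup_{k=1}^L T_k\subseteq\mathbb{R}^n$ be a compact semialgebraic set, where $$T_k=\{x\in\mathbb{R}^n:\ f_{k,1}(x)=\cdots=f_{k,m_{k,1}}(x)=0,\ h_{k,1}(x)\ge 0,\dots,h_{k,m_{k,2}}(x)\ge 0\}$$ with polynomials $f_{k,i},h_{k,j}$. If for each $T_k$ the PDLH condition holds at every $u\in\partial_cT\cap\partial T_k$, then $\mathrm{conv}(T)$ is SDP representable.
   Context: For a set $T\subseteq\mathbb{R}^n$, the convex boundary is $\partial_cT=\{u\in T:\ \ell^Tu=\min_{x\in T}\ell^Tx\text{ for some }\ell\in\mathbb{R}^n\text{ with }\|\ell\|=1\}$. $\partial$ is topological boundary. A set $S\subseteq\mathbb{R}^n$ is SDP representable if there are $N\ge 0$ and real symmetric matrices $A_0,A_1,\dots,A_n,B_1,\dots,B_N$ of a common size such that $S=\{x\in\mathbb{R}^n:\exists u\in\mathbb{R}^N,\ A_0+\sum_{i=1}^n x_iA_i+\sum_{j=1}^N u_jB_j\succeq 0\}$, where $\succeq 0$ means positive semidefinite (and $\succ 0$ positive definite). PDLH (positive definite Lagrange Hessian) condition. Let a basic closed semialgebraic set $P=\{x: f_1(x)=\cdots=f_{m_1}(x)=0,\ h_1(x)\ge0,\dots,h_{m_2}(x)\ge0\}$ be given by polynomials, and let $u\in\partial P$. Then $P$ satisfies the PDLH condition at $u$ if there exists $\delta_u>0$ such that for every unit vector $\ell\in\mathbb{R}^n$ and every $0<\delta\le\delta_u$ the following holds. Put $m=m_2+1$ and $h_m(x)=\delta^2-\|x-u\|^2$.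 For any global minimizer $v$ of $\ell^Tx$ subject to $f_1(x)=\cdots=f_{m_1}(x)=0$, $h_1(x)\ge0,\dots,h_{m_2}(x)\ge 0$, $h_m(x)\ge 0$, the first order optimality (KKT) condition holds, i.e. there exist $\lambda_1,\dots,\lambda_{m_1}\in\mathbb{R}$ and $\mu_1,\dots,\mu_m\ge 0$ with $$\ell=\sum_{i=1}^{m_1}\lambda_i\nabla f_i(v)+\sum_{j=1}^m\mu_j\nabla h_j(v),\qquad \mu_jh_j(v)=0\ (1\le j\le m),$$ and the Hessian of the associated Lagrange function satisfies $$-\sum_{i=1}^{m_1}\lambda_i\nabla^2f_i(x)-\sum_{j=1}^m\mu_j\nabla^2h_j(x)\succ 0\quad\text{for all }x\text{ with }\|x-u\|\le\delta.$$ *)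

theory Defs
  imports "HOL-Analysis.Analysis"
begin

definition gradient :: "(real^'n \<Rightarrow> real) \<Rightarrow> real^'n \<Rightarrow> real^'n" where
  "gradient f x = (THE D. GDERIV f x :> D)"

definition hessian :: "(real^'n \<Rightarrow> real) \<Rightarrow> real^'n \<Rightarrow> real^'n^'n" where
  "hessian f x = jacobian (gradient f) (at x)"

definition positive_definite :: "real^'n^'n \<Rightarrow> bool" where
  "positive_definite A \<longleftrightarrow> transpose A = A \<and> (\<forall>z. z \<noteq> 0 \<longrightarrow> 0 < z \<bullet> (A *v z))"

definition basic_closed ::
  "nat \<Rightarrow> (nat \<Rightarrow> real^'n \<Rightarrow> real) \<Rightarrow> nat \<Rightarrow> (nat \<Rightarrow> real^'n \<Rightarrow> real) \<Rightarrow> (real^'n) set" where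
  "basic_closed m1 f m2 h = {x. (\<forall>i\<in>{1..m1}. f i x = 0) \<and> (\<forall>j\<in>{1..m2}. 0 \<le> h j x)}"

definition convex_boundary :: "(real^'n) set \<Rightarrow> (real^'n) set" where
  "convex_boundary T = {u \<in> T. \<exists>l. norm l = 1 \<and> is_arg_min (\<lambda>x. l \<bullet> x) (\<lambda>x. x \<in> T) u}"

text \<open>
  The condition depends on the chosen description of the set, not only on the set.
  The Hessian requirement is imposed on the multipliers that witness the KKT condition.
\<close>

definition PDLH_at ::
  "nat \<Rightarrow> (nat \<Rightarrow> real^'n \<Rightarrow> real) \<Rightarrow> nat \<Rightarrow> (nat \<Rightarrow> real^'n \<Rightarrow> real) \<Rightarrow> real^'n \<Rightarrow> bool" where
  "PDLH_at m1 f m2 h u \<longleftrightarrow>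
    (\<exists>\<delta>u>0. \<forall>l \<delta>. norm l = 1 \<and> 0 < \<delta> \<and> \<delta> \<le> \<delta>u \<longrightarrow>
      (let m = m2 + 1; g = h(m := \<lambda>x. \<delta>\<^sup>2 - (norm (x - u))\<^sup>2) in
       \<forall>v. is_arg_min (\<lambda>x. l \<bullet> x) (\<lambda>x. x \<in> basic_closed m1 f m g) v \<longrightarrow>
         (\<exists>(lam :: nat \<Rightarrow> real) (\<mu> :: nat \<Rightarrow> real).
            (\<forall>j\<in>{1..m}. 0 \<le> \<mu> j) \<and>
            l = (\<Sum>i=1..m1. lam i *\<^sub>R gradient (f i) v) + (\<Sum>j=1..m. \<mu> j *\<^sub>R gradient (g j) v) \<and>
            (\<forall>j\<in>{1..m}. \<mu> j * g j v = 0) \<and>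
            (\<forall>x. norm (x - u) \<le> \<delta> \<longrightarrow>
               positive_definite
                 (- (\<Sum>i=1..m1. lam i *\<^sub>R hessian (f i) x)
                  - (\<Sum>j=1..m. \<mu> j *\<^sub>R hessian (g j) x))))))"

text \<open>
  The size of a matrix inequality is quantified existentially, so these matrices cannot be
  indexed by a type: a \<open>d \<times> d\<close> matrix is a function on \<open>nat \<times> nat\<close>, of which only the
  entries with both indices below \<open>d\<close> matter.
\<close>

definition sym_mat :: "nat \<Rightarrow> (nat \<Rightarrow> nat \<Rightarrow> real) \<Rightarrow> bool" where
  "sym_mat d M \<longleftrightarrow> (\<forall>r<d. \<forall>c<d. M r c = M c r)"

definition positive_semidefinite :: "nat \<Rightarrow> (nat \<Rightarrow> nat \<Rightarrow> real) \<Rightarrow> bool" where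
  "positive_semidefinite d M \<longleftrightarrow>
    sym_mat d M \<and> (\<forall>z :: nat \<Rightarrow> real. 0 \<le> (\<Sum>r<d. \<Sum>c<d. z r * M r c * z c))"

definition SDP_representable :: "(real^'n) set \<Rightarrow> bool" where
  "SDP_representable S \<longleftrightarrow>
    (\<exists>(N :: nat) (d :: nat) (A0 :: nat \<Rightarrow> nat \<Rightarrow> real)
      (A :: 'n \<Rightarrow> nat \<Rightarrow> nat \<Rightarrow> real) (B :: nat \<Rightarrow> nat \<Rightarrow> nat \<Rightarrow> real).
       sym_mat d A0 \<and> (\<forall>i. sym_mat d (A i)) \<and> (\<forall>j\<in>{1..N}. sym_mat d (B j)) \<and>
       S = {x. \<exists>u :: nat \<Rightarrow> real.
              positive_semidefinite d
                (\<lambda>r c. A0 r c + (\<Sum>i\<in>UNIV. x $ i * A i r c) + (\<Sum>j=1..N. u j * B j r c))})"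

end

theory Submission
  imports Defs "HOL-Computational_Algebra.Polynomial"
begin

text \<open>
  The multipliers of the PDLH condition depend on the direction \<open>l\<close>, and a priori neither their
  size nor the definiteness of the Lagrange Hessian is uniform in \<open>l\<close>.  Uniformity comes from
  convex geometry.  Near a point of the convex boundary let \<open>S = {x. p\<^sub>j x \<ge> 0 for all j}\<close> be the
  intersection of a piece with a small closed ball \<open>B\<close>.  At \<open>v \<in> S\<close>, write an extreme ray \<open>r\<close> of the
  normal cone as the gradient of \<open>\<Sum>j. \<mu>\<^sub>j p\<^sub>j\<close>, a function with negative definite Hessian on \<open>B\<close>.
  Changing one positive \<open>\<mu>\<^sub>j\<close> slightly stays in the normal cone, so by extremality \<open>\<nabla>p\<^sub>j(v)\<close> is
  parallel to \<open>r\<close> for every \<open>j\<close> in the support of \<open>\<mu>\<close>.  Hence any other admissible multiplier with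
  the same support serves for \<open>r\<close> as well.  Fixing one multiplier for each possible support gives finitely
  many strictly concave polynomials \<open>g\<close> such that \<open>S\<close> and \<open>{x \<in> B. g x \<ge> 0 for all g}\<close> have the same
  convex hull.

  On a small ball a strictly concave polynomial is a concave quadratic form plus terms of order at least three,
  and the latter are combinations of powers of linear forms.  After a small multiple of \<open>s\<^sup>2\<close> is added, such a
  power \<open>a s\<^sup>n\<close> is convex, and Jensen's inequality for moment sequences represents its
  epigraph.  Compactness and the convex hull of a finite union finish the proof.
\<close>

section \<open>Linear matrix inequalities and convex hulls of unions\<close>

definition affine_in :: "nat \<Rightarrow> ('a::real_vector \<Rightarrow> (nat \<Rightarrow> real) \<Rightarrow> real) \<Rightarrow> bool" where
  "affine_in N F \<longleftrightarrow>
    (\<exists>a A b. linear A \<and> F = (\<lambda>x u. a + A x + (\<Sum>j<N. u j * b j)))"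

definition psd_on :: "'i set \<Rightarrow> ('i \<Rightarrow> 'i \<Rightarrow> real) \<Rightarrow> bool" where
  "psd_on I M \<longleftrightarrow> (\<forall>z. 0 \<le> (\<Sum>r\<in>I. \<Sum>c\<in>I. z r * M r c * z c))"

definition lmi :: "nat \<Rightarrow> ('a::real_vector \<Rightarrow> (nat \<Rightarrow> real) \<Rightarrow> bool) \<Rightarrow> bool" where
  "lmi N P \<longleftrightarrow>
    (\<exists>d (M :: nat \<Rightarrow> nat \<Rightarrow> 'a \<Rightarrow> (nat \<Rightarrow> real) \<Rightarrow> real).
      (\<forall>r<d. \<forall>c<d. affine_in N (M r c)) \<and> (\<forall>r<d. \<forall>c<d. M r c = M c r) \<and>
      P = (\<lambda>x u. psd_on {..<d} (\<lambda>r c. M r c x u)))"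

definition sdp :: "'a::real_vector set \<Rightarrow> bool" where
  "sdp S \<longleftrightarrow> (\<exists>N P. lmi N P \<and> S = {x. \<exists>u. P x u})"

lemma lmiE:
  assumes "lmi N P"
  obtains d :: nat and M where "\<And>r c. r < d \<Longrightarrow> c < d \<Longrightarrow> affine_in N (M r c)"
    "\<And>r c. r < d \<Longrightarrow> c < d \<Longrightarrow> M r c = M c r"
    "P = (\<lambda>x u. psd_on {..<d} (\<lambda>r c. M r c x u))"
proof -
  obtain d :: nat and M where *: "\<forall>r<d. \<forall>c<d. affine_in N (M r c)" "\<forall>r<d. \<forall>c<d. M r c = M c r"
    and P: "P = (\<lambda>x u. psd_on {..<d} (\<lambda>r c. M r c x u))"
    using assms unfolding lmi_def by (elim exE conjE)
  show thesis
    by (rule that[of d M]) (use * P in blast)+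
qed

lemma lmi_cong_vars:
  assumes "lmi N P" "\<And>j. j < N \<Longrightarrow> u j = v j"
  shows "P x u = P x v"
proof -
  obtain d :: nat and M where M: "\<And>r c. r < d \<Longrightarrow> c < d \<Longrightarrow> affine_in N (M r c)"
    "\<And>r c. r < d \<Longrightarrow> c < d \<Longrightarrow> M r c = M c r"
    "P = (\<lambda>x u. psd_on {..<d} (\<lambda>r c. M r c x u))" by (fact lmiE[OF assms(1)])
  have "M r c x u = M r c x v" if rc: "r < d" "c < d" for r c
  proof -
    obtain a A b where "M r c = (\<lambda>x u. a + A x + (\<Sum>j<N. u j * b j))"
      using M(1)[OF rc] unfolding affine_in_def by blast
    then show ?thesis using assms(2) by simp
  qed
  then show ?thesis unfolding M(3) psd_on_def by simp
qed

lemma affine_in_const: "affine_in N (\<lambda>x u. a)"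
  unfolding affine_in_def
  by (rule exI[of _ a], rule exI[of _ "\<lambda>_. 0"], rule exI[of _ "\<lambda>_. 0"]) (simp add: linear_zero)

lemma affine_in_linear: "linear A \<Longrightarrow> affine_in N (\<lambda>x u. A x)"
  unfolding affine_in_def
  by (rule exI[of _ 0], rule exI[of _ A], rule exI[of _ "\<lambda>_. 0"]) simp

lemma affine_in_var: "j < N \<Longrightarrow> affine_in N (\<lambda>x u. u j)"
  unfolding affine_in_def
  by (rule exI[of _ 0], rule exI[of _ "\<lambda>_. 0"], rule exI[of _ "\<lambda>i. if i = j then 1 else 0"])
    (simp add: linear_zero if_distrib[of "\<lambda>x. _ * x"] cong: if_cong)

lemma affine_in_add:
  assumes "affine_in N F" "affine_in N G"
  shows "affine_in N (\<lambda>x u. F x u + G x u)"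
proof -
  obtain a A b where F: "linear A" "F = (\<lambda>x u. a + A x + (\<Sum>j<N. u j * b j))"
    using assms(1) unfolding affine_in_def by blast
  obtain a' A' b' where G: "linear A'" "G = (\<lambda>x u. a' + A' x + (\<Sum>j<N. u j * b' j))"
    using assms(2) unfolding affine_in_def by blast
  show ?thesis
    unfolding affine_in_def
    by (rule exI[of _ "a + a'"], rule exI[of _ "\<lambda>x. A x + A' x"], rule exI[of _ "\<lambda>j. b j + b' j"])
      (simp add: F G linear_compose_add distrib_left sum.distrib add_ac)
qed

lemma affine_in_cmult:
  assumes "affine_in N F"
  shows "affine_in N (\<lambda>x u. k * F x u)"
proof -
  obtain a A b where F: "linear A" "F = (\<lambda>x u. a + A x + (\<Sum>j<N. u j * b j))"
    using assms unfolding affine_in_def by blast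
  have "linear (\<lambda>x. k * A x)"
    using linear_compose_scale_right[OF F(1), of k] by simp
  then show ?thesis
    unfolding affine_in_def
    by (intro exI[of _ "k * a"] exI[of _ "\<lambda>x. k * A x"] exI[of _ "\<lambda>j. k * b j"])
      (simp add: F distrib_left sum_distrib_left mult.left_commute)
qed

lemma affine_in_diff:
  "affine_in N F \<Longrightarrow> affine_in N G \<Longrightarrow> affine_in N (\<lambda>x u. F x u - G x u)"
  using affine_in_add[OF _ affine_in_cmult[of N G "-1"]] by simp

lemma affine_in_sum:
  "(\<And>i. i \<in> I \<Longrightarrow> affine_in N (F i)) \<Longrightarrow> affine_in N (\<lambda>x u. \<Sum>i\<in>I. F i x u)"
  by (induction I rule: infinite_finite_induct) (auto intro: affine_in_add affine_in_const)

lemma affine_in_subst: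
  assumes "affine_in N F"
    and "\<And>A. linear A \<Longrightarrow> affine_in N' (\<lambda>x u. A (\<phi> x u))"
    and "\<And>j. j < N \<Longrightarrow> affine_in N' (\<lambda>x u. \<psi> x u j)"
  shows "affine_in N' (\<lambda>x u. F (\<phi> x u) (\<psi> x u))"
proof -
  obtain a A b where "linear A" and F: "F = (\<lambda>x u. a + A x + (\<Sum>j<N. u j * b j))"
    using assms(1) unfolding affine_in_def by metis
  have "affine_in N' (\<lambda>x u. a + A (\<phi> x u) + (\<Sum>j<N. b j * \<psi> x u j))"
    by (intro affine_in_add affine_in_const affine_in_sum affine_in_cmult assms \<open>linear A\<close>) auto
  then show ?thesis unfolding F by (simp add: mult.commute)
qed

lemma psd_on_reindex:
  assumes "bij_betw e K I"
  shows "psd_on I M \<longleftrightarrow> psd_on K (\<lambda>r c. M (e r) (e c))"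
proof -
  have *: "(\<Sum>r\<in>I. \<Sum>c\<in>I. z r * M r c * z c) = (\<Sum>r\<in>K. \<Sum>c\<in>K. z (e r) * M (e r) (e c) * z (e c))"
    for z
    by (simp add: sum.reindex_bij_betw[OF assms, symmetric])
  have inj: "inj_on e K" using assms by (simp add: bij_betw_def)
  show ?thesis
  proof
    assume "psd_on I M"
    show "psd_on K (\<lambda>r c. M (e r) (e c))"
      unfolding psd_on_def
    proof
      fix z
      have "0 \<le> (\<Sum>r\<in>I. \<Sum>c\<in>I. z (inv_into K e r) * M r c * z (inv_into K e c))"
        using \<open>psd_on I M\<close>
        by (simp only: psd_on_def)
      then show "0 \<le> (\<Sum>r\<in>K. \<Sum>c\<in>K. z r * M (e r) (e c) * z c)"
        unfolding * by (simp add: inj cong: sum.cong)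
    qed
  next
    assume R: "psd_on K (\<lambda>r c. M (e r) (e c))"
    show "psd_on I M"
      unfolding psd_on_def *
    proof
      fix z
      show "0 \<le> (\<Sum>r\<in>K. \<Sum>c\<in>K. z (e r) * M (e r) (e c) * z (e c))"
        using R[unfolded psd_on_def, rule_format, of "\<lambda>i. z (e i)"] .
    qed
  qed
qed

lemma lmi_psd_on:
  fixes M :: "'i \<Rightarrow> 'i \<Rightarrow> 'a::real_vector \<Rightarrow> (nat \<Rightarrow> real) \<Rightarrow> real"
  assumes "finite I"
    and "\<And>r c. r \<in> I \<Longrightarrow> c \<in> I \<Longrightarrow> affine_in N (M r c)"
    and "\<And>r c. r \<in> I \<Longrightarrow> c \<in> I \<Longrightarrow> M r c = M c r"
  shows "lmi N (\<lambda>x u. psd_on I (\<lambda>r c. M r c x u))"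
proof -
  obtain e where e: "bij_betw e {..<card I} I"
    using ex_bij_betw_nat_finite[OF \<open>finite I\<close>] by (auto simp: atLeast0LessThan)
  then have eI: "e r \<in> I" if "r < card I" for r
    using that by (auto simp: bij_betw_def)
  show ?thesis
    unfolding lmi_def psd_on_reindex[OF e]
    by (rule exI[of _ "card I"], rule exI[of _ "\<lambda>r c. M (e r) (e c)"])
      (simp add: assms eI)
qed

lemma lmi_nonneg:
  assumes "affine_in N F"
  shows "lmi N (\<lambda>x u. 0 \<le> F x u)"
proof -
  have "lmi N (\<lambda>x u. psd_on {()} (\<lambda>r c. F x u))"
    by (rule lmi_psd_on) (use assms in auto)
  moreover have "psd_on {()} (\<lambda>r c. F x u) \<longleftrightarrow> 0 \<le> F x u" for x u
  proof
    show "psd_on {()} (\<lambda>r c. F x u) \<Longrightarrow> 0 \<le> F x u"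
      unfolding psd_on_def by (drule spec[of _ "\<lambda>_. 1"]) simp
    show "0 \<le> F x u \<Longrightarrow> psd_on {()} (\<lambda>r c. F x u)"
      using mult_nonneg_nonneg[OF _ zero_le_square, of "F x u" "z ()" for z]
      by (auto simp: psd_on_def mult_ac)
  qed
  ultimately show ?thesis by simp
qed

lemma psd_on_Plus:
  assumes "finite I" "finite J"
  shows "psd_on (I <+> J) (\<lambda>r c. case (r, c) of (Inl i, Inl i') \<Rightarrow> M i i' | (Inr j, Inr j') \<Rightarrow> M' j j'
      | _ \<Rightarrow> 0) \<longleftrightarrow> psd_on I M \<and> psd_on J M'" (is "psd_on _ ?B \<longleftrightarrow> _")
proof -
  have *: "(\<Sum>r\<in>I <+> J. \<Sum>c\<in>I <+> J. z r * ?B r c * z c)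
     = (\<Sum>r\<in>I. \<Sum>c\<in>I. z (Inl r) * M r c * z (Inl c)) + (\<Sum>r\<in>J. \<Sum>c\<in>J. z (Inr r) * M' r c * z (Inr c))" for z
    using assms by (simp add: sum.Plus)
  show ?thesis
  proof
    assume L: "psd_on (I <+> J) ?B"
    show "psd_on I M \<and> psd_on J M'"
      unfolding psd_on_def
    proof (intro conjI allI)
      fix z :: "'a \<Rightarrow> real"
      show "0 \<le> (\<Sum>r\<in>I. \<Sum>c\<in>I. z r * M r c * z c)"
        using L[unfolded psd_on_def *, rule_format, of "case_sum z (\<lambda>_. 0)"] by simp
    next
      fix z :: "'b \<Rightarrow> real"
      show "0 \<le> (\<Sum>r\<in>J. \<Sum>c\<in>J. z r * M' r c * z c)"
        using L[unfolded psd_on_def *, rule_format, of "case_sum (\<lambda>_. 0) z"] by simp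
    qed
  next
    assume R: "psd_on I M \<and> psd_on J M'"
    show "psd_on (I <+> J) ?B"
      unfolding psd_on_def *
      using R[unfolded psd_on_def] by (auto intro!: add_nonneg_nonneg)
  qed
qed

lemma lmi_conj:
  fixes P Q :: "'a::real_vector \<Rightarrow> (nat \<Rightarrow> real) \<Rightarrow> bool"
  assumes "lmi N P" "lmi N Q"
  shows "lmi N (\<lambda>x u. P x u \<and> Q x u)"
proof -
  obtain d :: nat and M where M: "\<And>r c. r < d \<Longrightarrow> c < d \<Longrightarrow> affine_in N (M r c)"
    "\<And>r c. r < d \<Longrightarrow> c < d \<Longrightarrow> M r c = M c r"
    "P = (\<lambda>x u. psd_on {..<d} (\<lambda>r c. M r c x u))" by (fact lmiE[OF assms(1)])
  obtain d' :: nat and M' where M': "\<And>r c. r < d' \<Longrightarrow> c < d' \<Longrightarrow> affine_in N (M' r c)"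
    "\<And>r c. r < d' \<Longrightarrow> c < d' \<Longrightarrow> M' r c = M' c r"
    "Q = (\<lambda>x u. psd_on {..<d'} (\<lambda>r c. M' r c x u))" by (fact lmiE[OF assms(2)])
  define B :: "nat + nat \<Rightarrow> nat + nat \<Rightarrow> 'a \<Rightarrow> (nat \<Rightarrow> real) \<Rightarrow> real"
    where "B r c x u = (case (r, c) of (Inl i, Inl i') \<Rightarrow> M i i' x u
     | (Inr j, Inr j') \<Rightarrow> M' j j' x u | _ \<Rightarrow> 0)" for r c x u
  have "lmi N (\<lambda>x u. psd_on ({..<d} <+> {..<d'}) (\<lambda>r c. B r c x u))"
  proof (rule lmi_psd_on)
    fix r c assume "r \<in> {..<d} <+> {..<d'}" "c \<in> {..<d} <+> {..<d'}"
    then show "affine_in N (B r c)" "B r c = B c r"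
      using M(1,2) M'(1,2) unfolding B_def
      by (auto simp: fun_eq_iff intro: affine_in_const)
  qed simp
  moreover have "psd_on ({..<d} <+> {..<d'}) (\<lambda>r c. B r c x u) \<longleftrightarrow> P x u \<and> Q x u" for x u
    unfolding B_def M(3) M'(3) by (rule psd_on_Plus) simp_all
  ultimately show ?thesis by simp
qed

lemma lmi_subst:
  assumes "lmi N P"
    and "\<And>A. linear A \<Longrightarrow> affine_in N' (\<lambda>x u. A (\<phi> x u))"
    and "\<And>j. j < N \<Longrightarrow> affine_in N' (\<lambda>x u. \<psi> x u j)"
  shows "lmi N' (\<lambda>x u. P (\<phi> x u) (\<psi> x u))"
proof -
  obtain d :: nat and M where M: "\<And>r c. r < d \<Longrightarrow> c < d \<Longrightarrow> affine_in N (M r c)"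
    "\<And>r c. r < d \<Longrightarrow> c < d \<Longrightarrow> M r c = M c r"
    "P = (\<lambda>x u. psd_on {..<d} (\<lambda>r c. M r c x u))" by (fact lmiE[OF assms(1)])
  show ?thesis
    unfolding lmi_def
  proof (intro exI conjI allI impI)
    fix r c assume "r < d" "c < d"
    then show "affine_in N' (\<lambda>x u. M r c (\<phi> x u) (\<psi> x u))"
      "(\<lambda>x u. M r c (\<phi> x u) (\<psi> x u)) = (\<lambda>x u. M c r (\<phi> x u) (\<psi> x u))"
      using M(1,2) by (auto intro!: affine_in_subst[OF _ assms(2,3)])
  qed (simp add: M(3))
qed

lemma sdp_halfspace:
  fixes A :: "'a::real_vector \<Rightarrow> real"
  assumes "linear A"
  shows "sdp {x. 0 \<le> a + A x}"
proof -
  have "lmi 0 (\<lambda>x u. 0 \<le> a + A x)"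
    by (intro lmi_nonneg affine_in_add affine_in_const affine_in_linear assms)
  then show ?thesis unfolding sdp_def by auto
qed

lemma sdp_UNIV: "sdp UNIV"
  using sdp_halfspace[OF linear_zero, of 1] by simp

lemma sdp_empty: "sdp {}"
  using sdp_halfspace[OF linear_zero, of "-1"] by simp

lemma sdp_Int:
  assumes "sdp S" "sdp T"
  shows "sdp (S \<inter> T)"
proof -
  obtain N P where P: "lmi N P" "S = {x. \<exists>u. P x u}" using assms(1) unfolding sdp_def by auto
  obtain N' Q where Q: "lmi N' Q" "T = {x. \<exists>u. Q x u}" using assms(2) unfolding sdp_def by auto
  have 1: "lmi (N + N') (\<lambda>x u. P x u)"
    using lmi_subst[OF P(1), of "N + N'" "\<lambda>x u. x" "\<lambda>x u. u"]
    by (auto simp: affine_in_linear affine_in_var)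
  have 2: "lmi (N + N') (\<lambda>x u. Q x (\<lambda>j. u (N + j)))"
    using lmi_subst[OF Q(1), of "N + N'" "\<lambda>x u. x" "\<lambda>x u j. u (N + j)"]
    by (auto simp: affine_in_linear affine_in_var)
  have "S \<inter> T = {x. \<exists>u. P x u \<and> Q x (\<lambda>j. u (N + j))}" (is "_ = ?R")
  proof
    show "?R \<subseteq> S \<inter> T" using P(2) Q(2) by auto
    show "S \<inter> T \<subseteq> ?R"
    proof
      fix x assume "x \<in> S \<inter> T"
      then obtain u v where uv: "P x u" "Q x v" using P(2) Q(2) by auto
      let ?w = "\<lambda>j. if j < N then u j else v (j - N)"
      have "P x ?w" using lmi_cong_vars[OF P(1), of u ?w x] uv by auto
      moreover have "Q x (\<lambda>j. ?w (N + j))" using uv(2) by simp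
      ultimately show "x \<in> ?R" by blast
    qed
  qed
  then show ?thesis unfolding sdp_def using lmi_conj[OF 1 2] by blast
qed

lemma sdp_INT:
  "finite I \<Longrightarrow> (\<And>i. i \<in> I \<Longrightarrow> sdp (S i)) \<Longrightarrow> sdp (\<Inter>i\<in>I. S i)"
  by (induction I rule: finite_induct) (auto intro: sdp_Int sdp_UNIV)

lemma sdp_affine_preimage:
  fixes \<phi> :: "'a::real_vector \<Rightarrow> 'b::real_vector"
  assumes "sdp S" "linear \<phi>"
  shows "sdp {x. c + \<phi> x \<in> S}"
proof -
  obtain N P where P: "lmi N P" "S = {x. \<exists>u. P x u}" using assms(1) unfolding sdp_def by auto
  have "lmi N (\<lambda>x u. P (c + \<phi> x) u)"
  proof (rule lmi_subst[OF P(1)])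
    fix A :: "'b \<Rightarrow> real" assume A: "linear A"
    have "affine_in N (\<lambda>x u. A c + (A \<circ> \<phi>) x)"
      by (intro affine_in_add affine_in_const affine_in_linear linear_compose assms A)
    then show "affine_in N (\<lambda>x u. A (c + \<phi> x))" using A by (simp add: linear_add)
  qed (rule affine_in_var)
  then show ?thesis unfolding sdp_def P(2) by blast
qed

lemma sdp_fst_image:
  fixes S :: "('a::real_vector \<times> 'b::euclidean_space) set"
  assumes "sdp S"
  shows "sdp (fst ` S)"
proof -
  obtain N P where P: "lmi N P" "S = {x. \<exists>u. P x u}" using assms unfolding sdp_def by auto
  obtain e where e: "bij_betw e {..<DIM('b)} (Basis :: 'b set)"
    using ex_bij_betw_nat_finite[OF finite_Basis] by (auto simp: atLeast0LessThan)
  define y where "y u = (\<Sum>k<DIM('b). u (N + k) *\<^sub>R e k)" for u :: "nat \<Rightarrow> real"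
  have "lmi (N + DIM('b)) (\<lambda>x u. P (x, y u) u)"
  proof (rule lmi_subst[OF P(1)])
    fix A :: "'a \<times> 'b \<Rightarrow> real" assume A: "linear A"
    have L1: "linear (\<lambda>x. A (x, 0))"
      using linear_compose[of "\<lambda>x. (x, 0)" A] A by (simp add: linear_iff o_def)
    have L2: "linear (\<lambda>y. A (0, y))"
      using linear_compose[of "\<lambda>y. (0, y)" A] A by (simp add: linear_iff o_def)
    have "A (x, y u) = A (x, 0) + (\<Sum>k<DIM('b). A (0, e k) * u (N + k))" for x u
    proof -
      have "A (x, y u) = A (x, 0) + A (0, y u)"
        using linear_add[OF A, of "(x, 0)" "(0, y u)"] by simp
      also have "A (0, y u) = (\<Sum>k<DIM('b). A (0, e k) * u (N + k))"
        unfolding y_def linear_sum[OF L2] linear_cmul[OF L2] by (simp add: mult.commute)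
      finally show ?thesis .
    qed
    then show "affine_in (N + DIM('b)) (\<lambda>x u. A (x, y u))"
      by (auto intro!: affine_in_add affine_in_linear affine_in_sum affine_in_cmult affine_in_var L1)
  qed (auto intro: affine_in_var)
  moreover have "fst ` S = {x. \<exists>u. P (x, y u) u}" (is "_ = ?R")
  proof
    show "?R \<subseteq> fst ` S" unfolding P(2) by force
    show "fst ` S \<subseteq> ?R"
    proof
      fix x assume "x \<in> fst ` S"
      then obtain z u where zu: "P (x, z) u" unfolding P(2) by auto
      let ?w = "\<lambda>j. if j < N then u j else z \<bullet> e (j - N)"
      have yz: "y ?w = z"
      proof -
        have "y ?w = (\<Sum>k<DIM('b). (z \<bullet> e k) *\<^sub>R e k)" unfolding y_def by simp
        also have "\<dots> = (\<Sum>b\<in>Basis. (z \<bullet> b) *\<^sub>R b)"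
          by (rule sum.reindex_bij_betw[OF e, of "\<lambda>b. (z \<bullet> b) *\<^sub>R b"])
        finally show ?thesis by (simp add: euclidean_representation)
      qed
      have "P (x, z) ?w" using lmi_cong_vars[OF P(1), of u ?w "(x, z)"] zu by auto
      then show "x \<in> ?R" using yz by (intro CollectI exI[of _ ?w]) simp
    qed
  qed
  ultimately show ?thesis unfolding sdp_def by blast
qed


text \<open>
  The cone over an \<open>sdp\<close> set is obtained by multiplying the constant matrix by a new
  variable, the scale.
\<close>

lemma sdp_cone:
  fixes S :: "'a::real_vector set"
  assumes "sdp S"
  obtains C :: "('a \<times> real) set" where "sdp C" "\<And>x. (x, 1) \<in> C \<longleftrightarrow> x \<in> S"
    "\<And>p q. p \<in> C \<Longrightarrow> q \<in> C \<Longrightarrow> p + q \<in> C"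
    "\<And>k p. 0 \<le> k \<Longrightarrow> p \<in> C \<Longrightarrow> k *\<^sub>R p \<in> C"
proof -
  obtain N P where P: "lmi N P" "S = {x. \<exists>u. P x u}" using assms unfolding sdp_def by auto
  obtain d :: nat and M where M: "\<And>r c. r < d \<Longrightarrow> c < d \<Longrightarrow> affine_in N (M r c)"
    "\<And>r c. r < d \<Longrightarrow> c < d \<Longrightarrow> M r c = M c r"
    "P = (\<lambda>x u. psd_on {..<d} (\<lambda>r c. M r c x u))" by (fact lmiE[OF P(1)])
  define H where "H F = (\<lambda>(x, k) u. k * F 0 (\<lambda>_. 0) + (F x u - F 0 (\<lambda>_. 0)))"
    for F :: "'a \<Rightarrow> (nat \<Rightarrow> real) \<Rightarrow> real"
  define Q where "Q p u = psd_on {..<d} (\<lambda>r c. H (M r c) p u)" for p u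
  have expl: "\<exists>a A b. linear A \<and> (\<forall>x k u. H F (x, k) u = k * a + A x + (\<Sum>j<N. u j * b j))"
    if aff: "affine_in N F" for F
  proof -
    obtain a A b where F: "linear A" "F = (\<lambda>x u. a + A x + (\<Sum>j<N. u j * b j))"
      using aff unfolding affine_in_def by blast
    have "H F (x, k) u = k * a + A x + (\<Sum>j<N. u j * b j)" for x k u
      unfolding H_def F(2) by (simp add: linear_0[OF F(1)])
    then show ?thesis using F(1) by blast
  qed
  have add: "H F (p + q) (\<lambda>j. u j + v j) = H F p u + H F q v" if "affine_in N F" for F p q u v
    using expl[OF that]
    by (cases p; cases q) (auto simp: linear_add distrib_right sum.distrib)
  have scale: "H F (k *\<^sub>R p) (\<lambda>j. k * u j) = k * H F p u" if "affine_in N F" for F k p u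
    using expl[OF that]
    by (cases p) (auto simp: linear_cmul distrib_left sum_distrib_left mult.assoc)
  have lmiQ: "lmi N Q"
    unfolding Q_def
  proof (rule lmi_psd_on)
    fix r c assume rc: "r \<in> {..<d}" "c \<in> {..<d}"
    show "H (M r c) = H (M c r)" using M(2)[of r c] rc by simp
    obtain a A b where *: "linear A" "\<And>x k u. H (M r c) (x, k) u = k * a + A x + (\<Sum>j<N. u j * b j)"
      using expl[OF M(1)[of r c]] rc by auto
    have "linear (\<lambda>p. a * snd p)" "linear (\<lambda>p. A (fst p))"
      using linear_compose[OF linear_snd, of "\<lambda>x. a * x"] linear_compose[OF linear_fst *(1)]
      by (auto simp: o_def linear_iff distrib_left)
    moreover have "H (M r c) = (\<lambda>p u. a * snd p + A (fst p) + (\<Sum>j<N. b j * u j))"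
      using *(2) by (auto simp: fun_eq_iff mult.commute)
    ultimately show "affine_in N (H (M r c))"
      by (simp only:) (intro affine_in_add affine_in_linear affine_in_sum affine_in_cmult affine_in_var, auto)
  qed simp
  show thesis
  proof (rule that[of "{p. \<exists>u. Q p u}"])
    show "sdp {p. \<exists>u. Q p u}" using lmiQ unfolding sdp_def by blast
    show "(x, 1) \<in> {p. \<exists>u. Q p u} \<longleftrightarrow> x \<in> S" for x
      unfolding P(2) Q_def M(3) H_def by simp
    show "p + q \<in> {p. \<exists>u. Q p u}" if pq: "p \<in> {p. \<exists>u. Q p u}" "q \<in> {p. \<exists>u. Q p u}" for p q
    proof -
      obtain u v where "Q p u" "Q q v" using pq by auto
      then have "Q (p + q) (\<lambda>j. u j + v j)"
        unfolding Q_def psd_on_def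
        by (simp add: add M(1) distrib_left distrib_right sum.distrib)
      then show ?thesis by blast
    qed
    show "k *\<^sub>R p \<in> {p. \<exists>u. Q p u}" if k: "0 \<le> k" "p \<in> {p. \<exists>u. Q p u}" for k p
    proof -
      obtain u where "Q p u" using k by auto
      then have "0 \<le> k * (\<Sum>r<d. \<Sum>c<d. z r * H (M r c) p u * z c)" for z
        using \<open>0 \<le> k\<close> unfolding Q_def psd_on_def by simp
      then have "Q (k *\<^sub>R p) (\<lambda>j. k * u j)"
        unfolding Q_def psd_on_def
        by (simp add: scale M(1) sum_distrib_left mult_ac)
      then show ?thesis by blast
    qed
  qed
qed

lemma sdp_convex:
  fixes S :: "'a::real_vector set"
  assumes "sdp S"
  shows "convex S"
proof -
  obtain C :: "('a \<times> real) set" where C: "sdp C" "\<And>x. (x, 1) \<in> C \<longleftrightarrow> x \<in> S"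
    "\<And>p q. p \<in> C \<Longrightarrow> q \<in> C \<Longrightarrow> p + q \<in> C"
    "\<And>k p. 0 \<le> k \<Longrightarrow> p \<in> C \<Longrightarrow> k *\<^sub>R p \<in> C" by (fact sdp_cone[OF assms])
  show ?thesis
  proof (rule convexI)
    fix x y and a b :: real assume "x \<in> S" "y \<in> S" and ab: "0 \<le> a" "0 \<le> b" "a + b = 1"
    then have "a *\<^sub>R (x, 1) + b *\<^sub>R (y, 1::real) \<in> C"
      by (intro C(3,4)) (auto simp: C(2))
    then show "a *\<^sub>R x + b *\<^sub>R y \<in> S" using ab C(2) by simp
  qed
qed

lemma sdp_convex_hull_Un:
  fixes S T :: "'a::euclidean_space set"
  assumes "sdp S" "sdp T" "bounded S" "bounded T" "S \<noteq> {}" "T \<noteq> {}"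
  shows "sdp (convex hull (S \<union> T))"
proof -
  have rec: "x = 0" if S: "bounded S" "S \<noteq> {}" "\<And>x. (x, 1) \<in> C \<longleftrightarrow> x \<in> S"
    "\<And>p q. p \<in> C \<Longrightarrow> q \<in> C \<Longrightarrow> p + q \<in> C"
    "\<And>k p. 0 \<le> k \<Longrightarrow> p \<in> C \<Longrightarrow> k *\<^sub>R p \<in> C" "(x, 0) \<in> C"
    for S and C :: "('a \<times> real) set" and x
  proof (rule ccontr)
    assume "x \<noteq> 0"
    obtain B y where B: "\<And>x. x \<in> S \<Longrightarrow> norm x \<le> B" "y \<in> S"
      using S(1,2) unfolding bounded_iff by blast
    define k where "k = (B + norm y + 1) / norm x"
    have "0 \<le> norm y" "norm y \<le> B" using B by auto
    then have "0 \<le> k" unfolding k_def by (intro divide_nonneg_nonneg norm_ge_zero) linarith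
    have "(y, 1) + k *\<^sub>R (x, 0) \<in> C"
      using S(3-6) B(2) \<open>0 \<le> k\<close> by blast
    then have "(y + k *\<^sub>R x, 1) \<in> C" by simp
    then have "norm (y + k *\<^sub>R x) \<le> B" using S(3) B(1) by blast
    moreover have "norm (k *\<^sub>R x) \<le> norm (y + k *\<^sub>R x) + norm y"
      using norm_triangle_ineq4[of "y + k *\<^sub>R x" y] by simp
    moreover have "norm (k *\<^sub>R x) = B + norm y + 1"
    proof -
      have "0 \<le> B + norm y + 1" using \<open>0 \<le> norm y\<close> \<open>norm y \<le> B\<close> by linarith
      then show ?thesis using \<open>x \<noteq> 0\<close> by (simp add: k_def)
    qed
    ultimately show False by simp
  qed
  obtain C :: "('a \<times> real) set" where C: "sdp C" "\<And>x. (x, 1) \<in> C \<longleftrightarrow> x \<in> S"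
    "\<And>p q. p \<in> C \<Longrightarrow> q \<in> C \<Longrightarrow> p + q \<in> C"
    "\<And>k p. 0 \<le> k \<Longrightarrow> p \<in> C \<Longrightarrow> k *\<^sub>R p \<in> C" by (fact sdp_cone[OF assms(1)])
  obtain D :: "('a \<times> real) set" where D: "sdp D" "\<And>x. (x, 1) \<in> D \<longleftrightarrow> x \<in> T"
    "\<And>p q. p \<in> D \<Longrightarrow> q \<in> D \<Longrightarrow> p + q \<in> D"
    "\<And>k p. 0 \<le> k \<Longrightarrow> p \<in> D \<Longrightarrow> k *\<^sub>R p \<in> D" by (fact sdp_cone[OF assms(2)])
  have recC: "x = 0" if "(x, 0) \<in> C" for x
    by (rule rec[OF \<open>bounded S\<close> \<open>S \<noteq> {}\<close> C(2-4) that])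
  have recD: "x = 0" if "(x, 0) \<in> D" for x
    by (rule rec[OF \<open>bounded T\<close> \<open>T \<noteq> {}\<close> D(2-4) that])
  have scaleC: "(1 / k) *\<^sub>R x \<in> S" if "(x, k) \<in> C" "0 < k" for x k
    using C(4)[of "1 / k" "(x, k)"] that by (simp add: C(2))
  have scaleD: "(1 / k) *\<^sub>R x \<in> T" if "(x, k) \<in> D" "0 < k" for x k
    using D(4)[of "1 / k" "(x, k)"] that by (simp add: D(2))
  define E :: "('a \<times> ('a \<times> real)) set" where
    "E = {p. 0 + snd p \<in> C} \<inter> {p. (0, 1) + (fst p - fst (snd p), - snd (snd p)) \<in> D}
       \<inter> {p. 0 \<le> 0 + snd (snd p)} \<inter> {p. 0 \<le> 1 + - snd (snd p)}"
  have "sdp E"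
    unfolding E_def
    by (intro sdp_Int sdp_affine_preimage[OF C(1)] sdp_affine_preimage[OF D(1)] sdp_halfspace)
      (auto simp: linear_iff algebra_simps)
  then have "sdp (fst ` E)" by (rule sdp_fst_image)
  moreover have "fst ` E = convex hull (S \<union> T)"
  proof
    show "fst ` E \<subseteq> convex hull (S \<union> T)"
    proof
      fix x assume "x \<in> fst ` E"
      then obtain y k where *: "(y, k) \<in> C" "(x - y, 1 - k) \<in> D" "0 \<le> k" "k \<le> 1"
        unfolding E_def by auto
      have hull: "S \<subseteq> convex hull (S \<union> T)" "T \<subseteq> convex hull (S \<union> T)"
        using hull_subset[of "S \<union> T" convex] by auto
      consider "k = 0" | "k = 1" | "0 < k" "k < 1" using * by linarith
      then show "x \<in> convex hull (S \<union> T)"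
      proof cases
        case 1
        then have "y = 0" using * recC by simp
        then have "x \<in> T" using 1 * D(2) by simp
        then show ?thesis using hull by blast
      next
        case 2
        then have "x = y" using * recD by fastforce
        then have "x \<in> S" using 2 * C(2) by simp
        then show ?thesis using hull by blast
      next
        case 3
        then have "(1 / k) *\<^sub>R y \<in> convex hull (S \<union> T)"
          "(1 / (1 - k)) *\<^sub>R (x - y) \<in> convex hull (S \<union> T)"
          using scaleC[OF *(1)] scaleD[OF *(2)] hull by auto
        from convexD[OF convex_convex_hull this, of k "1 - k"] 3
        show ?thesis by simp
      qed
    qed
    show "convex hull (S \<union> T) \<subseteq> fst ` E"
    proof (rule hull_minimal)
      show "convex (fst ` E)" by (rule sdp_convex) fact
      have "0 \<in> C" "0 \<in> D"
        using C(4)[of 0] D(4)[of 0] C(2) D(2) assms(5,6) by fastforce+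
      then have "(x, x, 1) \<in> E" if "x \<in> S" for x
        unfolding E_def using that by (simp add: C(2) zero_prod_def)
      moreover have "(x, 0, 0) \<in> E" if "x \<in> T" for x
        unfolding E_def using that \<open>0 \<in> C\<close> by (simp add: D(2) zero_prod_def)
      ultimately show "S \<union> T \<subseteq> fst ` E" by force
    qed
  qed
  ultimately show ?thesis by simp
qed

lemma sdp_convex_hull_UN:
  fixes S :: "'i \<Rightarrow> 'a::euclidean_space set"
  assumes "finite I" "\<And>i. i \<in> I \<Longrightarrow> sdp (convex hull (S i))" "\<And>i. i \<in> I \<Longrightarrow> bounded (S i)"
  shows "sdp (convex hull (\<Union>i\<in>I. S i))"
  using assms
proof (induction I rule: finite_induct)
  case empty
  then show ?case by (simp add: sdp_empty)
next
  case (insert i I)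
  have IH: "sdp (convex hull (\<Union>i\<in>I. S i))" and i: "sdp (convex hull (S i))"
    using insert by auto
  have b: "bounded (convex hull (\<Union>i\<in>I. S i))" "bounded (convex hull (S i))"
    using insert by (auto intro!: bounded_convex_hull bounded_UN)
  have eq: "convex hull (convex hull (S i) \<union> convex hull (\<Union>i\<in>I. S i)) = convex hull (\<Union>i\<in>insert i I. S i)"
    by (simp only: UN_insert) (metis hull_Un_left hull_Un_right)
  show ?case
  proof (cases "S i = {} \<or> (\<Union>i\<in>I. S i) = {}")
    case True
    then show ?thesis
    proof
      assume "(\<Union>i\<in>I. S i) = {}"
      then have "(\<Union>i\<in>insert i I. S i) = S i" by auto
      then show ?thesis using i by (simp only:)
    next
      assume "S i = {}"
      then have "(\<Union>i\<in>insert i I. S i) = (\<Union>i\<in>I. S i)" by auto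
      then show ?thesis using IH by (simp only:)
    qed
  next
    case False
    then have "convex hull (S i) \<noteq> {}" "convex hull (\<Union>i\<in>I. S i) \<noteq> {}" by simp_all
    from sdp_convex_hull_Un[OF i IH b(2,1) this] show ?thesis unfolding eq .
  qed
qed

lemma sdp_imp_SDP_representable:
  fixes S :: "(real^'n) set"
  assumes "sdp S"
  shows "SDP_representable S"
proof -
  obtain N P where P: "lmi N P" "S = {x. \<exists>u. P x u}" using assms unfolding sdp_def by auto
  obtain d :: nat and M where M: "\<And>r c. r < d \<Longrightarrow> c < d \<Longrightarrow> affine_in N (M r c)"
    "\<And>r c. r < d \<Longrightarrow> c < d \<Longrightarrow> M r c = M c r"
    "P = (\<lambda>x u. psd_on {..<d} (\<lambda>r c. M r c x u))" by (fact lmiE[OF P(1)])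
  define A0 where "A0 r c = M r c 0 (\<lambda>_. 0)" for r c
  define A where "A i r c = M r c (axis i 1) (\<lambda>_. 0) - A0 r c" for i r c
  define B where "B j r c = M r c 0 (\<lambda>i. if i = j - 1 then 1 else 0) - A0 r c" for j r c
  have Meq: "M r c x u = A0 r c + (\<Sum>i\<in>UNIV. x $ i * A i r c) + (\<Sum>j=1..N. u (j - 1) * B j r c)"
    if rc: "r < d" "c < d" for r c x u
  proof -
    obtain a L b where L: "linear L" and MF: "M r c = (\<lambda>x u. a + L x + (\<Sum>j<N. u j * b j))"
      using M(1)[OF rc] unfolding affine_in_def by blast
    have "L x = (\<Sum>i\<in>UNIV. x $ i * L (axis i 1))"
      using linear_sum[OF L, of "\<lambda>i. x $ i *\<^sub>R axis i 1" UNIV] basis_expansion[of x]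
      by (simp add: linear_cmul[OF L] scalar_mult_eq_scaleR)
    moreover have "A i r c = L (axis i 1)" "A0 r c = a" for i
      unfolding A_def A0_def MF by (simp_all add: linear_0[OF L])
    moreover have "B j r c = b (j - 1)" if "j \<in> {1..N}" for j
    proof -
      have "(\<Sum>i<N. (if i = j - 1 then 1 else 0) * b i) = b (j - 1)"
        using that by (auto simp: if_distrib[of "\<lambda>x. x * _"] cong: if_cong)
      then show ?thesis unfolding B_def A0_def MF by simp
    qed
    moreover have "(\<Sum>j=1..N. u (j - 1) * b (j - 1)) = (\<Sum>j<N. u j * b j)"
      using sum.atLeast1_atMost_eq[of "\<lambda>j. u (j - 1) * b (j - 1)" N] by simp
    ultimately show ?thesis unfolding MF by simp
  qed
  have sym: "sym_mat d A0" "sym_mat d (A i)" "sym_mat d (B j)" for i j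
    unfolding sym_mat_def A0_def A_def B_def using M(2) by auto
  have psd: "P x (\<lambda>j. u (Suc j)) \<longleftrightarrow> positive_semidefinite d
      (\<lambda>r c. A0 r c + (\<Sum>i\<in>UNIV. x $ i * A i r c) + (\<Sum>j=1..N. u j * B j r c))" (is "_ \<longleftrightarrow> positive_semidefinite d ?M")
    for x u
  proof -
    have e: "M r c x (\<lambda>j. u (Suc j)) = ?M r c" if "r < d" "c < d" for r c
      using Meq[OF that, of x "\<lambda>j. u (Suc j)"] by simp
    have "sym_mat d ?M"
      unfolding sym_mat_def
    proof (intro allI impI)
      fix r c assume rc: "r < d" "c < d"
      show "?M r c = ?M c r" unfolding e[OF rc, symmetric] e[OF rc(2,1), symmetric] M(2)[OF rc] ..
    qed
    then show ?thesis
      unfolding M(3) psd_on_def positive_semidefinite_def by (simp add: e)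
  qed
  have "S = {x. \<exists>u. positive_semidefinite d
      (\<lambda>r c. A0 r c + (\<Sum>i\<in>UNIV. x $ i * A i r c) + (\<Sum>j=1..N. u j * B j r c))}"
  proof -
    have "(\<exists>u. P x u) \<longleftrightarrow> (\<exists>u. P x (\<lambda>j. u (Suc j)))" for x
    proof
      assume "\<exists>u. P x u"
      then obtain u where "P x u" ..
      then show "\<exists>u. P x (\<lambda>j. u (Suc j))" by (intro exI[of _ "\<lambda>k. u (k - 1)"]) simp
    qed blast
    then show ?thesis unfolding P(2) psd by simp
  qed
  then show ?thesis
    unfolding SDP_representable_def
    by (intro exI[of _ N] exI[of _ d] exI[of _ A0] exI[of _ A] exI[of _ B] conjI allI ballI sym)
qed

section \<open>Epigraphs of quadratic forms and of univariate powers\<close>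

lemma sdp_quadratic_epigraph:
  fixes b :: "'a::euclidean_space \<Rightarrow> 'a \<Rightarrow> real"
  assumes b: "bilinear b" and sym: "\<And>x y. b x y = b y x" and nonneg: "\<And>x. 0 \<le> b x x"
  shows "sdp {p. b (fst p) (fst p) \<le> snd p}"
proof -
  define M :: "'a option \<Rightarrow> 'a option \<Rightarrow> 'a \<times> real \<Rightarrow> (nat \<Rightarrow> real) \<Rightarrow> real"
    where "M r c p u = (case r of None \<Rightarrow> (case c of None \<Rightarrow> snd p | Some j \<Rightarrow> b j (fst p))
      | Some i \<Rightarrow> (case c of None \<Rightarrow> b i (fst p) | Some j \<Rightarrow> b i j))" for r c p u
  let ?I = "insert None (Some ` Basis) :: 'a option set"
  have lin: "linear (b i)" for i using b by (simp add: bilinear_def)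
  have lin': "linear (\<lambda>x. b x y)" for y using b by (simp add: bilinear_def)
  have "lmi 0 (\<lambda>p u. psd_on ?I (\<lambda>r c. M r c p u))"
  proof (rule lmi_psd_on)
    fix r c assume "r \<in> ?I" "c \<in> ?I"
    have "linear (\<lambda>p :: 'a \<times> real. b i (fst p))" for i
      using linear_compose[OF linear_fst lin, of i] by (simp add: o_def)
    then show "affine_in 0 (M r c)"
      unfolding M_def
      by (cases r; cases c) (auto intro: affine_in_const affine_in_linear linear_snd)
    show "M r c = M c r"
      unfolding M_def by (cases r; cases c) (auto simp: sym)
  qed simp
  moreover have "psd_on ?I (\<lambda>r c. M r c (y, t) u) \<longleftrightarrow> b y y \<le> t" for y t u
  proof -
    have QF: "(\<Sum>r\<in>?I. \<Sum>c\<in>?I. z r * M r c (y, t) u * z c)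
      = b (w + z None *\<^sub>R y) (w + z None *\<^sub>R y) + (z None)\<^sup>2 * (t - b y y)"
      if "w = (\<Sum>i\<in>Basis. z (Some i) *\<^sub>R i)" for z w
    proof -
      have 1: "b w x = (\<Sum>i\<in>Basis. z (Some i) * b i x)" for x
        unfolding that linear_sum[OF lin'] by (simp add: linear_cmul[OF lin'])
      have "(\<Sum>r\<in>?I. \<Sum>c\<in>?I. z r * M r c (y, t) u * z c)
        = z None * t * z None + (\<Sum>j\<in>Basis. z None * b j y * z (Some j))
          + ((\<Sum>i\<in>Basis. z (Some i) * b i y * z None)
          + (\<Sum>i\<in>Basis. \<Sum>j\<in>Basis. z (Some i) * b i j * z (Some j)))"
        by (simp add: sum.reindex M_def sum.distrib)
      also have "(\<Sum>j\<in>Basis. z None * b j y * z (Some j)) = z None * b w y"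
        unfolding 1 by (simp add: sum_distrib_left mult_ac)
      also have "(\<Sum>i\<in>Basis. z (Some i) * b i y * z None) = z None * b w y"
        unfolding 1 by (simp add: sum_distrib_left mult_ac)
      also have "(\<Sum>i\<in>Basis. \<Sum>j\<in>Basis. z (Some i) * b i j * z (Some j)) = b w w"
      proof -
        have "(\<Sum>j\<in>Basis. z (Some i) * b i j * z (Some j)) = z (Some i) * b i w" for i
        proof -
          have "b i w = b w i" by (rule sym)
          also have "\<dots> = (\<Sum>j\<in>Basis. z (Some j) * b i j)"
            unfolding 1 by (intro sum.cong refl arg_cong[where f = "(*) _"] sym)
          finally show ?thesis by (simp add: sum_distrib_left mult_ac)
        qed
        then show ?thesis by (simp add: 1[of w])
      qed
      finally have S: "(\<Sum>r\<in>?I. \<Sum>c\<in>?I. z r * M r c (y, t) u * z c)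
        = z None * t * z None + z None * b w y + (z None * b w y + b w w)" .
      have "b (w + z None *\<^sub>R y) (w + z None *\<^sub>R y)
        = b w w + z None * b w y + z None * (b w y + z None * b y y)"
        unfolding linear_add[OF lin] linear_add[OF lin'] linear_cmul[OF lin] linear_cmul[OF lin']
          real_scaleR_def sym[of y w] by simp
      then show ?thesis unfolding S by (simp only: power2_eq_square) (simp add: algebra_simps)
    qed
    show ?thesis
    proof
      assume L: "psd_on ?I (\<lambda>r c. M r c (y, t) u)"
      define z where "z r = (case r of None \<Rightarrow> 1 | Some i \<Rightarrow> - (y \<bullet> i))" for r
      have "- y = (\<Sum>i\<in>Basis. z (Some i) *\<^sub>R i)"
        unfolding z_def by (simp add: sum_negf euclidean_representation)
      from L[unfolded psd_on_def, rule_format, of z]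
      have "0 \<le> b (- y + z None *\<^sub>R y) (- y + z None *\<^sub>R y) + (z None)\<^sup>2 * (t - b y y)"
        unfolding QF[OF \<open>- y = _\<close>] .
      then show "b y y \<le> t" by (simp add: z_def linear_0[OF lin])
    next
      assume "b y y \<le> t"
      then show "psd_on ?I (\<lambda>r c. M r c (y, t) u)"
        unfolding psd_on_def QF[OF refl] using nonneg by simp
    qed
  qed
  ultimately show ?thesis
    unfolding sdp_def by (intro exI[of _ 0] exI[of _ "\<lambda>p u. psd_on ?I (\<lambda>r c. M r c p u)"])
      (auto simp: set_eq_iff)
qed

lemma power_tangent_remainder:
  fixes x v :: "'a::comm_ring_1"
  shows "x ^ (n + 2) - v ^ (n + 2) - of_nat (n + 2) * v ^ (n + 1) * (x - v)
    = (x - v)\<^sup>2 * (\<Sum>k\<le>n. of_nat (k + 1) * v ^ k * x ^ (n - k))"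
proof (induction n)
  case 0
  show ?case by (simp add: power2_eq_square algebra_simps)
next
  case (Suc n)
  have "(\<Sum>k\<le>Suc n. of_nat (k + 1) * v ^ k * x ^ (Suc n - k))
    = x * (\<Sum>k\<le>n. of_nat (k + 1) * v ^ k * x ^ (n - k)) + of_nat (n + 2) * v ^ (n + 1)"
    by (simp add: sum_distrib_left Suc_diff_le mult_ac)
  then have "(x - v)\<^sup>2 * (\<Sum>k\<le>Suc n. of_nat (k + 1) * v ^ k * x ^ (Suc n - k))
    = x * (x ^ (n + 2) - v ^ (n + 2) - of_nat (n + 2) * v ^ (n + 1) * (x - v))
      + (x - v)\<^sup>2 * (of_nat (n + 2) * v ^ (n + 1))"
    unfolding Suc.IH by (simp add: algebra_simps)
  then show ?case by (simp add: power2_eq_square algebra_simps)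
qed

text \<open>
  \<open>Lf\<close> stands for the integration against a moment sequence; the two positivity assumptions are
  the moment and localizing matrices of the interval.  The conclusion is Jensen's inequality
  for a function whose second derivative is nonnegative by an explicit sum of squares,
  based on \<open>2 (1 \<plusminus> X ^ i) = (1 \<plusminus> X ^ i)\<^sup>2 + (1 - X\<^sup>2) (\<Sum>m<i. X ^ (2 m))\<close>.
\<close>

lemma jensen_moments:
  fixes Lf :: "real poly \<Rightarrow> real"
  assumes lin: "\<And>p q. Lf (p + q) = Lf p + Lf q" "\<And>a p. Lf (smult a p) = a * Lf p"
    and one: "Lf 1 = 1"
    and pos1: "\<And>p. degree p \<le> n + 2 \<Longrightarrow> 0 \<le> Lf (p * p)"
    and pos2: "\<And>p. degree p \<le> n + 2 \<Longrightarrow> 0 \<le> Lf ([:1, 0, -1:] * (p * p))"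
    and v: "v = Lf (monom 1 1)" and \<sigma>: "\<bar>\<sigma>\<bar> \<le> 1"
    and M: "M = (\<Sum>k\<le>n. real (k + 1))"
  shows "\<bar>v\<bar> \<le> 1"
    and "M * v\<^sup>2 + \<sigma> * v ^ (n + 2) \<le> M * Lf (monom 1 2) + \<sigma> * Lf (monom 1 (n + 2))"
proof -
  have Lsum: "Lf (\<Sum>i\<in>I. p i) = (\<Sum>i\<in>I. Lf (p i))" for I :: "nat set" and p
    using lin(2)[of 0 1]
    by (induction I rule: infinite_finite_induct) (auto simp: lin(1))
  let ?X = "[:- v, 1:]"
  have X2: "Lf (?X * ?X) = Lf (monom 1 2) - v\<^sup>2"
  proof -
    have "?X * ?X = monom 1 2 + smult (- 2 * v) (monom 1 1) + smult (v\<^sup>2) 1"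
      by (simp add: poly_eq_poly_eq_iff[symmetric] fun_eq_iff poly_monom power2_eq_square algebra_simps)
    then show ?thesis by (simp only: lin one v[symmetric]) (simp add: power2_eq_square)
  qed
  have "Lf (monom 1 2) \<le> 1"
  proof -
    have "[:1, 0, -1:] * (1 * 1) = 1 + smult (-1) (monom 1 2 :: real poly)"
      by (simp add: poly_eq_poly_eq_iff[symmetric] fun_eq_iff poly_monom power2_eq_square)
    then show ?thesis using pos2[of 1] by (simp only: lin one) simp
  qed
  moreover have "0 \<le> Lf (?X * ?X)" by (rule pos1) simp
  ultimately have "v\<^sup>2 \<le> 1" using X2 by simp
  then show v1: "\<bar>v\<bar> \<le> 1" by (simp add: abs_square_le_1)
  have half: "0 \<le> Lf (?X * ?X * (1 + smult s (monom 1 i)))" if "i \<le> n" "s * s = 1" for i s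
  proof -
    have d1: "degree (?X * (1 + smult s (monom 1 i))) \<le> n + 2"
    proof -
      have "degree (1 + smult s (monom 1 i)) \<le> i"
        by (rule degree_add_le) (auto intro: order_trans[OF degree_smult_le] degree_monom_le)
      then show ?thesis using degree_mult_le[of ?X "1 + smult s (monom 1 i)"] that(1) by simp
    qed
    have d2: "degree (?X * monom 1 m) \<le> n + 2" if "m < i" for m
      using degree_mult_le[of ?X "monom 1 m"] degree_monom_le[of "1::real" m] that \<open>i \<le> n\<close> by simp
    have "smult 2 (?X * ?X * (1 + smult s (monom 1 i)))
      = ?X * (1 + smult s (monom 1 i)) * (?X * (1 + smult s (monom 1 i)))
        + (\<Sum>m<i. [:1, 0, -1:] * (?X * monom 1 m * (?X * monom 1 m)))"
      unfolding poly_eq_poly_eq_iff[symmetric] fun_eq_iff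
    proof
      fix x :: real
      have geo: "(1 - x * x) * (\<Sum>m<i. x ^ m * x ^ m) = 1 - x ^ i * x ^ i"
        using one_diff_power_eq[of "x * x" i] by (simp add: power_mult_distrib)
      have "(\<Sum>m<i. (1 - x * x) * ((x - v) * x ^ m * ((x - v) * x ^ m)))
        = (x - v)\<^sup>2 * ((1 - x * x) * (\<Sum>m<i. x ^ m * x ^ m))"
        by (simp add: sum_distrib_left power2_eq_square mult_ac)
      also have "\<dots> = (x - v)\<^sup>2 * (1 - (s * s) * (x ^ i * x ^ i))" unfolding geo that(2) by simp
      finally show "poly (smult 2 (?X * ?X * (1 + smult s (monom 1 i)))) x
        = poly (?X * (1 + smult s (monom 1 i)) * (?X * (1 + smult s (monom 1 i)))
        + (\<Sum>m<i. [:1, 0, -1:] * (?X * monom 1 m * (?X * monom 1 m)))) x"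
        by (simp add: poly_sum poly_monom power2_eq_square algebra_simps)
    qed
    then have "2 * Lf (?X * ?X * (1 + smult s (monom 1 i)))
      = Lf (?X * (1 + smult s (monom 1 i)) * (?X * (1 + smult s (monom 1 i))))
        + (\<Sum>m<i. Lf ([:1, 0, -1:] * (?X * monom 1 m * (?X * monom 1 m))))"
      by (metis lin Lsum)
    also have "\<dots> \<ge> 0"
      using pos1[OF d1] pos2[OF d2] by (intro add_nonneg_nonneg sum_nonneg) auto
    finally show ?thesis by simp
  qed
  have pos: "0 \<le> Lf (?X * ?X * (1 + smult \<beta> (monom 1 i)))" if "i \<le> n" "\<bar>\<beta>\<bar> \<le> 1" for i \<beta>
  proof -
    have "?X * ?X * (1 + smult \<beta> (monom 1 i))
      = smult ((1 + \<beta>) / 2) (?X * ?X * (1 + smult 1 (monom 1 i)))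
        + smult ((1 - \<beta>) / 2) (?X * ?X * (1 + smult (-1) (monom 1 i)))"
      by (simp add: poly_eq_poly_eq_iff[symmetric] fun_eq_iff poly_monom field_simps)
    then have "Lf (?X * ?X * (1 + smult \<beta> (monom 1 i)))
      = (1 + \<beta>) / 2 * Lf (?X * ?X * (1 + smult 1 (monom 1 i)))
        + (1 - \<beta>) / 2 * Lf (?X * ?X * (1 + smult (-1) (monom 1 i)))" by (simp only: lin)
    moreover have "0 \<le> (1 + \<beta>) / 2" "0 \<le> (1 - \<beta>) / 2" using that(2) by auto
    ultimately show ?thesis
      using half[OF that(1), of 1] half[OF that(1), of "-1"] by (metis add_nonneg_nonneg
          mult_nonneg_nonneg mult_minus1 mult_1 minus_minus)
  qed
  define c where "c = M * (2 * v) + \<sigma> * (real (n + 2) * v ^ (n + 1))"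
  have "smult M (monom 1 2) + smult \<sigma> (monom 1 (n + 2))
      + smult (- c) (monom 1 1) + smult (c * v - (M * v\<^sup>2 + \<sigma> * v ^ (n + 2))) 1
    = (\<Sum>k\<le>n. smult (real (k + 1)) (?X * ?X * (1 + smult (\<sigma> * v ^ k) (monom 1 (n - k)))))"
    unfolding poly_eq_poly_eq_iff[symmetric] fun_eq_iff
  proof
    fix x :: real
    have pX: "poly ?X x = x - v" by simp
    have "(\<Sum>k\<le>n. real (k + 1) * ((x - v)\<^sup>2 * (1 + \<sigma> * v ^ k * x ^ (n - k))))
      = M * (x - v)\<^sup>2 + \<sigma> * ((x - v)\<^sup>2 * (\<Sum>k\<le>n. of_nat (k + 1) * v ^ k * x ^ (n - k)))"
      unfolding M by (simp add: sum_distrib_left sum_distrib_right sum.distrib[symmetric] algebra_simps)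
    also have "\<dots> = M * (x - v)\<^sup>2 + \<sigma> * (x ^ (n + 2) - v ^ (n + 2) - of_nat (n + 2) * v ^ (n + 1) * (x - v))"
      unfolding power_tangent_remainder ..
    also have "\<dots> = M * x\<^sup>2 + \<sigma> * x ^ (n + 2) - c * x + (c * v - (M * v\<^sup>2 + \<sigma> * v ^ (n + 2)))"
      unfolding c_def by (simp add: power2_eq_square algebra_simps)
    finally show "poly (smult M (monom 1 2) + smult \<sigma> (monom 1 (n + 2))
      + smult (- c) (monom 1 1) + smult (c * v - (M * v\<^sup>2 + \<sigma> * v ^ (n + 2))) 1) x
      = poly (\<Sum>k\<le>n. smult (real (k + 1)) (?X * ?X * (1 + smult (\<sigma> * v ^ k) (monom 1 (n - k))))) x"
      unfolding poly_add poly_smult poly_mult poly_sum poly_monom poly_1 pX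
      by (simp add: power2_eq_square mult.assoc)
  qed
  then have "Lf (smult M (monom 1 2) + smult \<sigma> (monom 1 (n + 2))
      + smult (- c) (monom 1 1) + smult (c * v - (M * v\<^sup>2 + \<sigma> * v ^ (n + 2))) 1)
    = (\<Sum>k\<le>n. real (k + 1) * Lf (?X * ?X * (1 + smult (\<sigma> * v ^ k) (monom 1 (n - k)))))"
    by (simp only: Lsum lin)
  also have "\<dots> \<ge> 0"
  proof (intro sum_nonneg mult_nonneg_nonneg pos)
    fix k assume "k \<in> {..n}"
    have "\<bar>v\<bar> ^ k \<le> 1" using v1 by (simp add: power_le_one)
    then show "\<bar>\<sigma> * v ^ k\<bar> \<le> 1"
      using \<sigma> by (simp add: abs_mult power_abs mult_le_one)
  qed auto
  finally show "M * v\<^sup>2 + \<sigma> * v ^ (n + 2) \<le> M * Lf (monom 1 2) + \<sigma> * Lf (monom 1 (n + 2))"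
    by (simp only: lin one v[symmetric]) simp
qed

lemma sdp_power_epigraph_unit:
  assumes \<sigma>: "\<bar>\<sigma>\<bar> \<le> 1" and M: "M = (\<Sum>k\<le>n. real (k + 1))"
  shows "sdp {p :: real \<times> real. \<bar>fst p\<bar> \<le> 1 \<and> M * (fst p)\<^sup>2 + \<sigma> * fst p ^ (n + 2) \<le> snd p}"
proof -
  define N where "N = 2 * (n + 2) + 3"
  define y :: "nat \<Rightarrow> real \<times> real \<Rightarrow> (nat \<Rightarrow> real) \<Rightarrow> real"
    where "y k p u = (if k = 0 then 1 else if k = 1 then fst p else u k)" for k p u
  have y_aff: "affine_in N (y k)" if "k < N" for k
    unfolding y_def using that
    by (cases "k = 0"; cases "k = 1")
      (auto intro: affine_in_const affine_in_linear[OF linear_fst] affine_in_var)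
  define P where "P p u \<longleftrightarrow> psd_on {..n + 2} (\<lambda>r c. y (r + c) p u)
    \<and> psd_on {..n + 2} (\<lambda>r c. y (r + c) p u - y (r + c + 2) p u)
    \<and> 0 \<le> snd p - (M * y 2 p u + \<sigma> * y (n + 2) p u)" for p u
  have lmiP: "lmi N (\<lambda>p u. P p u)"
    unfolding P_def
    by (intro lmi_conj lmi_psd_on lmi_nonneg affine_in_diff affine_in_add affine_in_cmult y_aff
        affine_in_linear linear_snd) (auto simp: N_def add_ac)
  have *: "(\<exists>u. P (s, t) u) \<longleftrightarrow> \<bar>s\<bar> \<le> 1 \<and> M * s\<^sup>2 + \<sigma> * s ^ (n + 2) \<le> t" for s t
  proof
    assume "\<bar>s\<bar> \<le> 1 \<and> M * s\<^sup>2 + \<sigma> * s ^ (n + 2) \<le> t"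
    then have s: "\<bar>s\<bar> \<le> 1" "M * s\<^sup>2 + \<sigma> * s ^ (n + 2) \<le> t" by auto
    have y: "y k (s, t) (\<lambda>k. s ^ k) = s ^ k" for k unfolding y_def by simp
    have 1: "(\<Sum>r\<le>K. \<Sum>c\<le>K. z r * s ^ (r + c) * z c) = (\<Sum>r\<le>K. z r * s ^ r)\<^sup>2"
      for z and K :: nat
      by (simp add: power2_eq_square sum_product power_add mult_ac)
    have "(\<Sum>r\<le>K. \<Sum>c\<le>K. z r * (s ^ (r + c) - s ^ (r + c + 2)) * z c)
      = (1 - s\<^sup>2) * (\<Sum>r\<le>K. \<Sum>c\<le>K. z r * s ^ (r + c) * z c)" for z and K :: nat
      unfolding sum_distrib_left by (simp add: power_add algebra_simps power2_eq_square)
    moreover have "0 \<le> 1 - s\<^sup>2" using s(1) by (simp add: abs_square_le_1)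
    ultimately have "P (s, t) (\<lambda>k. s ^ k)"
      unfolding P_def psd_on_def y 1 using s(2) by (auto simp only: 1 intro!: mult_nonneg_nonneg) auto
    then show "\<exists>u. P (s, t) u" by blast
  next
    assume "\<exists>u. P (s, t) u"
    then obtain u where u: "P (s, t) u" ..
    define Lf where "Lf p = (\<Sum>k<N. coeff p k * y k (s, t) u)" for p
    have lin: "Lf (p + q) = Lf p + Lf q" "Lf (smult a p) = a * Lf p" "Lf (p - q) = Lf p - Lf q" for p q a
      unfolding Lf_def by (simp_all add: sum.distrib sum_subtractf sum_distrib_left algebra_simps)
    have Lsum: "Lf (\<Sum>i\<in>I. p i) = (\<Sum>i\<in>I. Lf (p i))" for I :: "nat set" and p
      using lin(2)[of 0 1]
      by (induction I rule: infinite_finite_induct) (auto simp: lin(1))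
    have Lm: "Lf (monom a k) = a * y k (s, t) u" if "k < N" for a k
      unfolding Lf_def using that by (simp add: coeff_monom if_distrib[of "\<lambda>x. x * _"] cong: if_cong)
    have sq: "p * p = (\<Sum>r\<le>n + 2. \<Sum>c\<le>n + 2. monom (coeff p r * coeff p c) (r + c))"
      if "degree p \<le> n + 2" for p :: "real poly"
    proof -
      have "p = (\<Sum>r\<le>n + 2. monom (coeff p r) r)"
        using poly_as_sum_of_monoms'[OF that] by simp
      then have "p * p = (\<Sum>r\<le>n + 2. monom (coeff p r) r) * (\<Sum>r\<le>n + 2. monom (coeff p r) r)"
        by metis
      then show ?thesis by (simp only: sum_product mult_monom)
    qed
    have "0 \<le> Lf (p * p)" if "degree p \<le> n + 2" for p
    proof -
      have "Lf (p * p) = (\<Sum>r\<le>n + 2. \<Sum>c\<le>n + 2. coeff p r * y (r + c) (s, t) u * coeff p c)"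
        unfolding sq[OF that] Lsum
        by (intro sum.cong refl) (subst Lm, auto simp: N_def)
      then show ?thesis using u unfolding P_def psd_on_def by auto
    qed
    moreover have "0 \<le> Lf ([:1, 0, -1:] * (p * p))" if "degree p \<le> n + 2" for p
    proof -
      have "[:1, 0, -1:] * (p * p) = p * p - monom 1 2 * (p * p)"
        by (simp add: poly_eq_poly_eq_iff[symmetric] fun_eq_iff poly_monom power2_eq_square algebra_simps)
      also have "\<dots> = (\<Sum>r\<le>n + 2. \<Sum>c\<le>n + 2. monom (coeff p r * coeff p c) (r + c)
          - monom (coeff p r * coeff p c) (r + c + 2))"
        unfolding sq[OF that] sum_distrib_left mult_monom by (simp add: sum_subtractf add_ac)
      finally have "Lf ([:1, 0, -1:] * (p * p))
        = (\<Sum>r\<le>n + 2. \<Sum>c\<le>n + 2. coeff p r * (y (r + c) (s, t) u - y (r + c + 2) (s, t) u) * coeff p c)"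
        by (simp only: Lsum lin) (intro sum.cong refl, subst Lm, simp add: N_def, subst Lm,
            auto simp: N_def algebra_simps)
      then show ?thesis using u unfolding P_def psd_on_def by auto
    qed
    moreover have "Lf 1 = 1"
      using Lm[of 0 1] by (simp add: N_def y_def monom_0 one_pCons)
    moreover have "s = Lf (monom 1 1)" by (subst Lm) (simp_all add: N_def y_def)
    ultimately have "\<bar>s\<bar> \<le> 1" "M * s\<^sup>2 + \<sigma> * s ^ (n + 2) \<le> M * Lf (monom 1 2) + \<sigma> * Lf (monom 1 (n + 2))"
      using jensen_moments[where Lf = Lf and n = n and v = s and M = M and \<sigma> = \<sigma>] lin \<sigma> M by blast+
    moreover have "Lf (monom 1 2) = y 2 (s, t) u" "Lf (monom 1 (n + 2)) = y (n + 2) (s, t) u"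
      by (subst Lm; simp add: N_def)+
    ultimately show "\<bar>s\<bar> \<le> 1 \<and> M * s\<^sup>2 + \<sigma> * s ^ (n + 2) \<le> t"
      using u unfolding P_def by auto
  qed
  have "{p. \<bar>fst p\<bar> \<le> 1 \<and> M * (fst p)\<^sup>2 + \<sigma> * fst p ^ (n + 2) \<le> snd p} = {p. \<exists>u. P p u}"
    by (rule set_eqI) (simp only: split_paired_all mem_Collect_eq * fst_conv snd_conv)
  then show ?thesis
    using lmiP unfolding sdp_def by blast
qed

section \<open>Polynomials as combinations of powers of affine forms\<close>

definition sdp_epigraph :: "'a::real_vector set \<Rightarrow> ('a \<Rightarrow> real) \<Rightarrow> bool" where
  "sdp_epigraph D \<phi> \<longleftrightarrow> sdp {p. fst p \<in> D \<and> \<phi> (fst p) \<le> snd p}"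

lemma sdp_epigraph_add:
  assumes "sdp_epigraph D \<phi>" "sdp_epigraph D' \<psi>"
  shows "sdp_epigraph (D \<inter> D') (\<lambda>x. \<phi> x + \<psi> x)"
proof -
  let ?S = "{p. fst p \<in> D \<and> \<phi> (fst p) \<le> snd p}" and ?T = "{p. fst p \<in> D' \<and> \<psi> (fst p) \<le> snd p}"
  let ?E = "{q. 0 + (fst (fst q), snd q) \<in> ?S} \<inter> {q. 0 + (fst (fst q), snd (fst q) - snd q) \<in> ?T}"
  have "sdp (fst ` ?E)"
    by (intro sdp_fst_image sdp_Int sdp_affine_preimage)
      (use assms in \<open>auto simp: sdp_epigraph_def linear_iff algebra_simps\<close>)
  moreover have "fst ` ?E = {p. fst p \<in> D \<inter> D' \<and> \<phi> (fst p) + \<psi> (fst p) \<le> snd p}" (is "_ = ?R")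
  proof
    show "fst ` ?E \<subseteq> ?R" by auto
    show "?R \<subseteq> fst ` ?E"
    proof
      fix p assume "p \<in> ?R"
      then have "(p, \<phi> (fst p)) \<in> ?E" by auto
      then show "p \<in> fst ` ?E" by (rule image_eqI[rotated]) simp
    qed
  qed
  ultimately show ?thesis unfolding sdp_epigraph_def by simp
qed

lemma sdp_epigraph_linear_compose:
  fixes A :: "'a::real_vector \<Rightarrow> 'b::real_vector"
  assumes "sdp_epigraph D \<phi>" "linear A"
  shows "sdp_epigraph {x. A x \<in> D} (\<lambda>x. \<phi> (A x))"
proof -
  have "linear (\<lambda>p :: 'a \<times> real. (A (fst p), snd p))"
    using assms(2) by (auto simp: linear_iff)
  from sdp_affine_preimage[OF assms(1)[unfolded sdp_epigraph_def] this, of 0]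
  show ?thesis unfolding sdp_epigraph_def by simp
qed

lemma sdp_epigraph_scale:
  assumes "sdp_epigraph D \<phi>" "0 < k"
  shows "sdp_epigraph D (\<lambda>x. k * \<phi> x)"
proof -
  have "linear (\<lambda>p :: 'a \<times> real. (fst p, snd p / k))"
    by (auto simp: linear_iff add_divide_distrib)
  from sdp_affine_preimage[OF assms(1)[unfolded sdp_epigraph_def] this, of 0]
  show ?thesis unfolding sdp_epigraph_def using assms(2) by (simp add: pos_le_divide_eq mult.commute)
qed

lemma sdp_epigraph_affine:
  fixes A :: "'a::real_vector \<Rightarrow> real"
  assumes "linear A"
  shows "sdp_epigraph UNIV (\<lambda>x. a + A x)"
proof -
  have "linear (\<lambda>p :: 'a \<times> real. snd p - A (fst p))"
    using assms by (auto simp: linear_iff algebra_simps)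
  from sdp_halfspace[OF this, of "- a"]
  show ?thesis unfolding sdp_epigraph_def by (simp add: algebra_simps)
qed

lemma sdp_epigraph_quadratic:
  fixes b :: "'a::euclidean_space \<Rightarrow> 'a \<Rightarrow> real"
  assumes "bilinear b" "\<And>x y. b x y = b y x" "\<And>x. 0 \<le> b x x"
  shows "sdp_epigraph UNIV (\<lambda>x. b x x)"
  using sdp_quadratic_epigraph[OF assms] unfolding sdp_epigraph_def by simp

lemma sdp_sublevel:
  assumes "sdp_epigraph D \<phi>"
  shows "sdp {x. c + x \<in> D \<and> \<phi> (c + x) \<le> 0}"
proof -
  have "linear (\<lambda>x :: 'a. (x, 0 :: real))" by (auto simp: linear_iff)
  from sdp_affine_preimage[OF assms[unfolded sdp_epigraph_def] this, of "(c, 0)"]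
  show ?thesis by simp
qed

lemma sdp_cball: "sdp (cball (c :: 'a::euclidean_space) r)"
proof (cases "0 \<le> r")
  case True
  have "sdp_epigraph UNIV (\<lambda>x :: 'a. x \<bullet> x)"
    by (rule sdp_epigraph_quadratic) (auto simp: bilinear_conv_bounded_bilinear bounded_bilinear_inner inner_commute)
  moreover have "sdp_epigraph UNIV (\<lambda>x :: 'a. - r\<^sup>2 + 0)"
    by (rule sdp_epigraph_affine) (rule linear_zero)
  ultimately have "sdp_epigraph (UNIV \<inter> UNIV) (\<lambda>x :: 'a. x \<bullet> x + (- r\<^sup>2 + 0))"
    by (rule sdp_epigraph_add)
  from sdp_sublevel[OF this, of "- c"]
  have "sdp {x. (- c + x) \<bullet> (- c + x) \<le> r\<^sup>2}" by simp
  moreover have "(- c + x) \<bullet> (- c + x) \<le> r\<^sup>2 \<longleftrightarrow> x \<in> cball c r" for x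
  proof -
    have "(- c + x) \<bullet> (- c + x) = (dist c x)\<^sup>2"
      by (simp add: power2_norm_eq_inner dist_norm norm_minus_commute[of c x])
    then show ?thesis using True by (simp add: power2_le_iff_abs_le)
  qed
  ultimately show ?thesis by (simp only: Collect_mem_eq)
qed (simp add: sdp_empty)

lemma sdp_epigraph_power:
  assumes "0 < R" "0 < \<epsilon>" and small: "(\<Sum>k\<le>n. real (k + 1)) * \<bar>a\<bar> * R ^ n \<le> \<epsilon>"
  shows "sdp_epigraph (cball 0 R) (\<lambda>s :: real. \<epsilon> * s\<^sup>2 + a * s ^ (n + 2))"
proof -
  define M where "M = (\<Sum>k\<le>n. real (k + 1))"
  have "0 < M" unfolding M_def by (intro sum_pos) auto
  define \<sigma> where "\<sigma> = a * R ^ n * M / \<epsilon>"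
  have "\<bar>\<sigma>\<bar> \<le> 1"
    using small \<open>0 < R\<close> \<open>0 < \<epsilon>\<close> \<open>0 < M\<close>
    by (simp only: M_def[symmetric]) (simp add: \<sigma>_def abs_mult mult_ac)
  then have "sdp_epigraph (cball 0 1) (\<lambda>s. M * s\<^sup>2 + \<sigma> * s ^ (n + 2))"
    using sdp_power_epigraph_unit[of \<sigma> M n] M_def by (simp add: sdp_epigraph_def)
  then have "sdp_epigraph (cball 0 1) (\<lambda>s. \<epsilon> * R\<^sup>2 / M * (M * s\<^sup>2 + \<sigma> * s ^ (n + 2)))"
    by (rule sdp_epigraph_scale) (use \<open>0 < R\<close> \<open>0 < \<epsilon>\<close> \<open>0 < M\<close> in simp)
  then have "sdp_epigraph {x. x / R \<in> cball 0 1} (\<lambda>s. \<epsilon> * R\<^sup>2 / M * (M * (s / R)\<^sup>2 + \<sigma> * (s / R) ^ (n + 2)))"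
    by (rule sdp_epigraph_linear_compose[where A = "\<lambda>s. s / R"])
      (auto simp: linear_iff add_divide_distrib)
  moreover have "{x. x / R \<in> cball 0 1} = cball 0 R"
    using \<open>0 < R\<close> by (auto simp: field_simps)
  moreover have "\<epsilon> * R\<^sup>2 / M * (M * (s / R)\<^sup>2 + \<sigma> * (s / R) ^ (n + 2)) = \<epsilon> * s\<^sup>2 + a * s ^ (n + 2)" for s
    using \<open>0 < R\<close> \<open>0 < \<epsilon>\<close> \<open>0 < M\<close>
    by (simp add: \<sigma>_def field_simps power2_eq_square power_divide)
  ultimately show ?thesis by simp
qed

lemma sdp_epigraph_higher_order:
  fixes a :: "nat \<Rightarrow> real"
  assumes "0 < \<epsilon>"
  shows "\<exists>R0>0. \<forall>R. 0 < R \<and> R \<le> R0 \<longrightarrow>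
    sdp_epigraph (cball 0 R) (\<lambda>s :: real. \<epsilon> * s\<^sup>2 + (\<Sum>j<J. a j * s ^ (j + 3)))"
  using assms
proof (induction J arbitrary: \<epsilon>)
  case 0
  then show ?case using sdp_epigraph_power[of _ \<epsilon> 0 0] by (intro exI[of _ 1]) auto
next
  case (Suc J)
  then obtain R1 where R1: "0 < R1" "\<And>R. 0 < R \<Longrightarrow> R \<le> R1 \<Longrightarrow>
    sdp_epigraph (cball 0 R) (\<lambda>s :: real. \<epsilon> / 2 * s\<^sup>2 + (\<Sum>j<J. a j * s ^ (j + 3)))"
    using Suc.IH[of "\<epsilon> / 2"] by auto
  define M where "M = (\<Sum>k\<le>J + 1. real (k + 1)) * \<bar>a J\<bar>"
  have "0 \<le> M" unfolding M_def by (intro mult_nonneg_nonneg sum_nonneg) auto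
  define R2 where "R2 = min 1 (\<epsilon> / 2 / (M + 1))"
  have "0 < R2" unfolding R2_def using \<open>0 \<le> M\<close> Suc.prems by simp
  show ?case
  proof (intro exI[of _ "min R1 R2"] conjI allI impI)
    show "0 < min R1 R2" using R1(1) \<open>0 < R2\<close> by simp
    fix R assume R: "0 < R \<and> R \<le> min R1 R2"
    have "R ^ (J + 1) \<le> R" using R by (simp add: R2_def power_le_one mult_left_le)
    also have "\<dots> \<le> \<epsilon> / 2 / (M + 1)" using R by (simp add: R2_def)
    finally have "M * R ^ (J + 1) \<le> M * (\<epsilon> / 2 / (M + 1))" using \<open>0 \<le> M\<close> by (rule mult_left_mono)
    also have "\<dots> \<le> \<epsilon> / 2" using \<open>0 \<le> M\<close> Suc.prems by (simp add: field_simps)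
    finally have "sdp_epigraph (cball 0 R) (\<lambda>s :: real. \<epsilon> / 2 * s\<^sup>2 + a J * s ^ (J + 1 + 2))"
      by (intro sdp_epigraph_power) (use R Suc.prems in \<open>auto simp: M_def\<close>)
    moreover have "sdp_epigraph (cball 0 R) (\<lambda>s :: real. \<epsilon> / 2 * s\<^sup>2 + (\<Sum>j<J. a j * s ^ (j + 3)))"
      using R by (intro R1(2)) auto
    ultimately have "sdp_epigraph (cball 0 R \<inter> cball 0 R)
      (\<lambda>s :: real. (\<epsilon> / 2 * s\<^sup>2 + (\<Sum>j<J. a j * s ^ (j + 3))) + (\<epsilon> / 2 * s\<^sup>2 + a J * s ^ (J + 1 + 2)))"
      by (intro sdp_epigraph_add)
    moreover have "(\<lambda>s :: real. (\<epsilon> / 2 * s\<^sup>2 + (\<Sum>j<J. a j * s ^ (j + 3))) + (\<epsilon> / 2 * s\<^sup>2 + a J * s ^ (J + 1 + 2)))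
      = (\<lambda>s. \<epsilon> * s\<^sup>2 + (\<Sum>j<Suc J. a j * s ^ (j + 3)))"
      by (rule ext) (simp add: numeral_3_eq_3)
    ultimately show "sdp_epigraph (cball 0 R) (\<lambda>s :: real. \<epsilon> * s\<^sup>2 + (\<Sum>j<Suc J. a j * s ^ (j + 3)))"
      by simp
  qed
qed

lemma power_taylor2:
  fixes \<alpha> :: real
  obtains a :: "nat \<Rightarrow> real" where "\<And>s. (\<alpha> + s) ^ d = \<alpha> ^ d + real d * \<alpha> ^ (d - 1) * s
    + real d * real (d - 1) * \<alpha> ^ (d - 2) / 2 * s\<^sup>2 + (\<Sum>j<d. a j * s ^ (j + 3))"
proof
  fix s :: real
  let ?t = "\<lambda>k. real (d choose k) * s ^ k * \<alpha> ^ (d - k)"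
  have "(\<alpha> + s) ^ d = (\<Sum>k\<le>d. ?t k)"
    by (subst add.commute) (rule binomial_ring)
  also have "\<dots> = (\<Sum>k<d + 3. ?t k)"
    by (rule sum.mono_neutral_left) auto
  also have "\<dots> = ?t 0 + (?t 1 + (?t 2 + (\<Sum>j<d. ?t (j + 3))))"
  proof -
    have "(\<Sum>k<d + 3. g k) = g 0 + (g 1 + (g 2 + (\<Sum>j<d. g (j + 3))))" for g :: "nat \<Rightarrow> real"
      by (induction d) (simp_all add: numeral_3_eq_3 numeral_2_eq_2)
    then show ?thesis .
  qed
  also have "real (d choose 2) = real d * real (d - 1) / 2"
    by (cases d) (simp_all add: choose_two real_of_nat_div algebra_simps)
  finally show "(\<alpha> + s) ^ d = \<alpha> ^ d + real d * \<alpha> ^ (d - 1) * s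
    + real d * real (d - 1) * \<alpha> ^ (d - 2) / 2 * s\<^sup>2
    + (\<Sum>j<d. (real (d choose (j + 3)) * \<alpha> ^ (d - (j + 3))) * s ^ (j + 3))"
    by (simp add: mult_ac)
qed

inductive power_span :: "('a::real_inner \<Rightarrow> real) \<Rightarrow> bool" where
  zero: "power_span (\<lambda>x. 0)"
| add_power: "power_span f \<Longrightarrow> power_span (\<lambda>x. a * (l \<bullet> x + c) ^ d + f x)"

lemma power_span_add: "power_span f \<Longrightarrow> power_span g \<Longrightarrow> power_span (\<lambda>x. f x + g x)"
proof (induction rule: power_span.induct)
  case (add_power f a l c d)
  then show ?case using power_span.add_power[of "\<lambda>x. f x + g x" a l c d] by (simp add: add.assoc)
qed simp

lemma power_span_power: "power_span (\<lambda>x. a * (l \<bullet> x + c) ^ d)"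
  using power_span.add_power[OF power_span.zero, of a l c d] by simp

lemma power_span_sum:
  "(\<And>i. i \<in> I \<Longrightarrow> power_span (f i)) \<Longrightarrow> power_span (\<lambda>x. \<Sum>i\<in>I. f i x)"
  by (induction I rule: infinite_finite_induct) (auto intro: power_span_add power_span.zero)

text \<open>Reading off a coefficient of \<open>(s + X t) ^ N\<close> by Lagrange interpolation at \<open>0, \<dots>, N\<close>.\<close>

lemma monomial_as_powers:
  obtains \<gamma> :: "nat \<Rightarrow> real"
  where "\<And>s t. s ^ a * t ^ b = (\<Sum>k\<le>a + b. \<gamma> k * (s + real k * t) ^ (a + b))"
proof -
  define N where "N = a + b"
  define \<Lambda> :: "nat \<Rightarrow> real poly"
    where "\<Lambda> k = (\<Prod>m\<in>{..N} - {k}. smult (1 / (real k - real m)) [:- real m, 1:])" for k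
  have \<Lambda>_eval: "poly (\<Lambda> k) (real i) = (if i = k then 1 else 0)" if "i \<le> N" "k \<le> N" for i k
  proof (cases "i = k")
    case True
    have "poly (smult (1 / (real k - real m)) [:- real m, 1:]) (real k) = 1" if "m \<noteq> k" for m
      using that by (simp add: diff_divide_distrib[symmetric])
    then show ?thesis unfolding True \<Lambda>_def poly_prod by (auto intro!: prod.neutral simp del: poly_smult)
  next
    case False
    then have "\<exists>m\<in>{..N} - {k}. poly (smult (1 / (real k - real m)) [:- real m, 1:]) (real i) = 0"
      using that by (intro bexI[of _ i]) auto
    then show ?thesis using False unfolding \<Lambda>_def poly_prod by (subst prod_zero) auto
  qed
  have \<Lambda>_deg: "degree (\<Lambda> k) \<le> N" if "k \<le> N" for k
  proof -
    have "degree (\<Lambda> k) \<le> (\<Sum>m\<in>{..N} - {k}. degree (smult (1 / (real k - real m)) [:- real m, 1:]))"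
      unfolding \<Lambda>_def
      using degree_prod_sum_le[of "{..N} - {k}" "\<lambda>m. smult (1 / (real k - real m)) [:- real m, 1:]"]
      by (simp only: o_def) simp
    also have "\<dots> \<le> (\<Sum>m\<in>{..N} - {k}. 1)"
      by (intro sum_mono order_trans[OF degree_smult_le]) simp
    also have "\<dots> \<le> N" using that by (simp add: card_Diff_singleton_if)
    finally show ?thesis .
  qed
  have interp: "coeff p b = (\<Sum>k\<le>N. poly p (real k) * coeff (\<Lambda> k) b)" if "degree p \<le> N" for p
  proof -
    have "p = (\<Sum>k\<le>N. smult (poly p (real k)) (\<Lambda> k))"
    proof (rule poly_eqI_degree[where A = "real ` {..N}"])
      fix x assume "x \<in> real ` {..N}"
      then obtain i where i: "i \<le> N" "x = real i" by auto
      have "(\<Sum>k\<le>N. poly p (real k) * poly (\<Lambda> k) (real i)) = (\<Sum>k\<le>N. if k = i then poly p (real k) else 0)"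
        using i(1) by (intro sum.cong) (auto simp: \<Lambda>_eval)
      then show "poly p x = poly (\<Sum>k\<le>N. smult (poly p (real k)) (\<Lambda> k)) x"
        unfolding i(2) using i(1) by (simp add: poly_sum)
    next
      have c: "card (real ` {..N}) = N + 1" by (simp add: card_image)
      show "degree p < card (real ` {..N})" using that c by simp
      have "degree (\<Sum>k\<le>N. smult (poly p (real k)) (\<Lambda> k)) \<le> N"
        by (intro degree_sum_le order_trans[OF degree_smult_le] \<Lambda>_deg) auto
      then show "degree (\<Sum>k\<le>N. smult (poly p (real k)) (\<Lambda> k)) < card (real ` {..N})" using c by simp
    qed
    then have "coeff p b = coeff (\<Sum>k\<le>N. smult (poly p (real k)) (\<Lambda> k)) b" by simp
    then show ?thesis by (simp add: coeff_sum)
  qed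
  show thesis
  proof
    fix s t :: real
    have "degree ([:s, t:] ^ N) \<le> N"
      using degree_power_le[of "[:s, t:]" N] by (simp split: if_splits)
    from interp[OF this]
    have "real (N choose b) * t ^ b * s ^ (N - b) = (\<Sum>k\<le>N. (s + real k * t) ^ N * coeff (\<Lambda> k) b)"
      by (simp add: coeff_linear_poly_power N_def)
    moreover have "0 < real (N choose b)" "N - b = a" by (simp_all add: N_def)
    ultimately have "s ^ a * t ^ b = (\<Sum>k\<le>N. (s + real k * t) ^ N * coeff (\<Lambda> k) b) / real (N choose b)"
      by (simp add: field_simps)
    then show "s ^ a * t ^ b = (\<Sum>k\<le>a + b. (coeff (\<Lambda> k) b / real (N choose b)) * (s + real k * t) ^ (a + b))"
      unfolding N_def by (simp add: sum_divide_distrib mult_ac)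
  qed
qed

lemma power_span_mult: "power_span f \<Longrightarrow> power_span g \<Longrightarrow> power_span (\<lambda>x. f x * g x)"
proof -
  have *: "power_span (\<lambda>x. (a * (l \<bullet> x + c) ^ d) * g x)" if "power_span g"
    for a c d and l :: 'a and g :: "'a \<Rightarrow> real"
    using that
  proof (induction rule: power_span.induct)
    case zero
    then show ?case by (simp add: power_span.zero)
  next
    case (add_power g a' l' c' d')
    obtain \<gamma> where \<gamma>: "\<And>s t :: real. s ^ d * t ^ d' = (\<Sum>k\<le>d + d'. \<gamma> k * (s + real k * t) ^ (d + d'))"
      by (fact monomial_as_powers)
    have "(a * (l \<bullet> x + c) ^ d) * (a' * (l' \<bullet> x + c') ^ d')
      = (\<Sum>k\<le>d + d'. (a * a' * \<gamma> k) * ((l + real k *\<^sub>R l') \<bullet> x + (c + real k * c')) ^ (d + d'))" for x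
    proof -
      have "(a * (l \<bullet> x + c) ^ d) * (a' * (l' \<bullet> x + c') ^ d')
        = a * a' * (\<Sum>k\<le>d + d'. \<gamma> k * ((l \<bullet> x + c) + real k * (l' \<bullet> x + c')) ^ (d + d'))"
        unfolding \<gamma>[symmetric] by simp
      then show ?thesis by (simp add: sum_distrib_left inner_add_left algebra_simps)
    qed
    then have "power_span (\<lambda>x. (a * (l \<bullet> x + c) ^ d) * (a' * (l' \<bullet> x + c') ^ d'))"
      by (simp add: power_span_sum power_span_power)
    then show ?case
      using power_span_add[OF _ add_power.IH] by (simp add: distrib_left)
  qed
  show "power_span f \<Longrightarrow> power_span g \<Longrightarrow> power_span (\<lambda>x. f x * g x)"
  proof (induction rule: power_span.induct)
    case zero
    then show ?case by (simp add: power_span.zero)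
  next
    case (add_power f a l c d)
    then show ?case using power_span_add[OF *[OF add_power.prems]] by (simp add: distrib_right)
  qed
qed

lemma real_polynomial_function_power_span:
  fixes f :: "'a::euclidean_space \<Rightarrow> real"
  assumes "real_polynomial_function f"
  shows "power_span f"
  using assms
proof (induction rule: real_polynomial_function.induct)
  case (linear f)
  have "f x = 1 * (adjoint f 1 \<bullet> x + 0) ^ 1" for x
    using adjoint_works[OF bounded_linear.linear[OF linear], of x 1] by (simp add: inner_commute)
  then have "f = (\<lambda>x. 1 * (adjoint f 1 \<bullet> x + 0) ^ 1)" by (rule ext)
  then show ?case using power_span_power[of 1 "adjoint f 1" 0 1] by (simp only:)
next
  case (const c)
  show ?case using power_span_power[of c 0 0 0] by simp
qed (auto intro: power_span_add power_span_mult)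

section \<open>Second order expansions of polynomials\<close>

lemma sdp_epigraph_restrict:
  assumes "sdp_epigraph D \<phi>" "sdp D'"
  shows "sdp_epigraph (D \<inter> D') \<phi>"
proof -
  have "sdp {p :: 'a \<times> real. 0 + fst p \<in> D'}"
    by (rule sdp_affine_preimage[OF assms(2) linear_fst])
  with assms(1) have "sdp ({p. fst p \<in> D \<and> \<phi> (fst p) \<le> snd p} \<inter> {p. 0 + fst p \<in> D'})"
    unfolding sdp_epigraph_def by (intro sdp_Int)
  moreover have "{p. fst p \<in> D \<and> \<phi> (fst p) \<le> snd p} \<inter> {p. 0 + fst p \<in> D'}
    = {p. fst p \<in> D \<inter> D' \<and> \<phi> (fst p) \<le> snd p}" by auto
  ultimately show ?thesis unfolding sdp_epigraph_def by simp
qed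

text \<open>
  Last clause: near every point, the negated remainder of the Taylor expansion of order two has a
  semidefinite representation once an arbitrarily small multiple of \<open>y \<bullet> y\<close> is added to it.
\<close>

definition quadratic_model ::
  "(real^'n \<Rightarrow> real) \<Rightarrow> (real^'n \<Rightarrow> real^'n) \<Rightarrow> (real^'n \<Rightarrow> real^'n^'n) \<Rightarrow> bool" where
  "quadratic_model f G H \<longleftrightarrow>
    (\<forall>x. GDERIV f x :> G x) \<and> (\<forall>x. (G has_derivative (\<lambda>z. H x *v z)) (at x)) \<and>
    continuous_on UNIV H \<and>
    (\<forall>w \<epsilon>. 0 < \<epsilon> \<longrightarrow> (\<exists>\<rho>0>0. \<forall>\<rho>. 0 < \<rho> \<and> \<rho> \<le> \<rho>0 \<longrightarrow>
      sdp_epigraph (cball 0 \<rho>)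
        (\<lambda>y. \<epsilon> * (y \<bullet> y) + (f w + G w \<bullet> y + y \<bullet> (H w *v y) / 2 - f (w + y)))))"

lemma sdp_epigraph_norm_square:
  fixes l :: "'a::euclidean_space"
  assumes "\<epsilon>' * (norm l)\<^sup>2 \<le> \<epsilon>" "0 \<le> \<epsilon>'"
  shows "sdp_epigraph UNIV (\<lambda>y. \<epsilon> * (y \<bullet> y) - \<epsilon>' * (l \<bullet> y)\<^sup>2)"
proof -
  have "sdp_epigraph UNIV (\<lambda>y :: 'a. \<epsilon> * (y \<bullet> y) - \<epsilon>' * ((l \<bullet> y) * (l \<bullet> y)))"
  proof (rule sdp_epigraph_quadratic[where b = "\<lambda>x y. \<epsilon> * (x \<bullet> y) - \<epsilon>' * ((l \<bullet> x) * (l \<bullet> y))"])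
    show "bilinear (\<lambda>x y :: 'a. \<epsilon> * (x \<bullet> y) - \<epsilon>' * ((l \<bullet> x) * (l \<bullet> y)))"
      unfolding bilinear_def linear_iff by (simp add: inner_add_left inner_add_right algebra_simps)
    fix x :: 'a
    have "(l \<bullet> x)\<^sup>2 \<le> (norm l * norm x)\<^sup>2"
      using Cauchy_Schwarz_ineq2[of l x] by (simp add: power2_le_iff_abs_le)
    then have "\<epsilon>' * (l \<bullet> x)\<^sup>2 \<le> (\<epsilon>' * (norm l)\<^sup>2) * (norm x)\<^sup>2"
      using assms(2) by (simp add: power_mult_distrib mult_left_mono mult.assoc)
    also have "\<dots> \<le> \<epsilon> * (norm x)\<^sup>2" using assms(1) by (intro mult_right_mono) auto
    finally show "0 \<le> \<epsilon> * (x \<bullet> x) - \<epsilon>' * ((l \<bullet> x) * (l \<bullet> x))"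
      by (simp add: dot_square_norm power2_eq_square)
  qed (simp add: inner_commute mult.commute)
  then show ?thesis by (simp add: power2_eq_square)
qed

lemma quadratic_model_zero: "quadratic_model (\<lambda>x. 0) (\<lambda>x. 0) (\<lambda>x. 0)"
proof -
  have "sdp_epigraph (cball 0 \<rho>) (\<lambda>y :: real^'n. \<epsilon> * (y \<bullet> y))" if "0 < \<epsilon>" for \<epsilon> \<rho>
    using sdp_epigraph_restrict[OF sdp_epigraph_norm_square[of 0 "0 :: real^'n" \<epsilon>] sdp_cball[of 0 \<rho>]] that
    by simp
  moreover have "((\<lambda>x. 0 :: real^'n) has_derivative (*v) 0) (at x)" for x :: "real^'n"
    by (rule has_derivative_eq_rhs[OF has_derivative_const]) (simp add: fun_eq_iff)
  ultimately show ?thesis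
    unfolding quadratic_model_def by (auto simp: GDERIV_const intro!: exI[of _ 1])
qed

lemma quadratic_model_add:
  fixes f f' :: "real^'n \<Rightarrow> real"
  assumes "quadratic_model f G H" "quadratic_model f' G' H'"
  shows "quadratic_model (\<lambda>x. f x + f' x) (\<lambda>x. G x + G' x) (\<lambda>x. H x + H' x)"
  unfolding quadratic_model_def
proof (intro conjI allI impI)
  show "GDERIV (\<lambda>x. f x + f' x) x :> G x + G' x" for x
    using assms unfolding quadratic_model_def by (intro GDERIV_add) auto
  show "((\<lambda>x. G x + G' x) has_derivative (*v) (H x + H' x)) (at x)" for x
    using assms unfolding quadratic_model_def matrix_vector_mult_add_rdistrib
    by (intro has_derivative_add) auto
  show "continuous_on UNIV (\<lambda>x. H x + H' x)"
    using assms unfolding quadratic_model_def by (intro continuous_on_add) auto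
  fix w :: "real^'n" and \<epsilon> :: real assume "0 < \<epsilon>"
  then have e: "0 < \<epsilon> / 2" by simp
  let ?R = "\<lambda>f G H y. \<epsilon> / 2 * (y \<bullet> y) + (f w + G w \<bullet> y + y \<bullet> (H w *v y) / 2 - f (w + y))"
  obtain \<rho>1 where 1: "0 < \<rho>1" "\<And>\<rho>. 0 < \<rho> \<and> \<rho> \<le> \<rho>1 \<Longrightarrow> sdp_epigraph (cball 0 \<rho>) (?R f G H)"
    using assms(1) e unfolding quadratic_model_def by meson
  obtain \<rho>2 where 2: "0 < \<rho>2" "\<And>\<rho>. 0 < \<rho> \<and> \<rho> \<le> \<rho>2 \<Longrightarrow> sdp_epigraph (cball 0 \<rho>) (?R f' G' H')"
    using assms(2) e unfolding quadratic_model_def by meson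
  have eq: "(\<lambda>y. ?R f G H y + ?R f' G' H' y) = (\<lambda>y. \<epsilon> * (y \<bullet> y)
    + ((f w + f' w) + (G w + G' w) \<bullet> y + y \<bullet> ((H w + H' w) *v y) / 2 - (f (w + y) + f' (w + y))))"
    by (rule ext) (simp add: matrix_vector_mult_add_rdistrib inner_add_left inner_add_right
        add_divide_distrib algebra_simps)
  show "\<exists>\<rho>0>0. \<forall>\<rho>. 0 < \<rho> \<and> \<rho> \<le> \<rho>0 \<longrightarrow> sdp_epigraph (cball 0 \<rho>) (\<lambda>y. \<epsilon> * (y \<bullet> y)
    + ((f w + f' w) + (G w + G' w) \<bullet> y + y \<bullet> ((H w + H' w) *v y) / 2 - (f (w + y) + f' (w + y))))"
  proof (intro exI[of _ "min \<rho>1 \<rho>2"] conjI allI impI)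
    show "0 < min \<rho>1 \<rho>2" using 1 2 by simp
    fix \<rho> assume "0 < \<rho> \<and> \<rho> \<le> min \<rho>1 \<rho>2"
    then have "sdp_epigraph (cball 0 \<rho> \<inter> cball 0 \<rho>) (\<lambda>y. ?R f G H y + ?R f' G' H' y)"
      using 1 2 by (intro sdp_epigraph_add) auto
    then show "sdp_epigraph (cball 0 \<rho>) (\<lambda>y. \<epsilon> * (y \<bullet> y)
    + ((f w + f' w) + (G w + G' w) \<bullet> y + y \<bullet> ((H w + H' w) *v y) / 2 - (f (w + y) + f' (w + y))))"
      unfolding eq by simp
  qed
qed

lemma quadratic_model_power:
  fixes l :: "real^'n" and a c :: real and d :: nat
  defines "D \<equiv> \<lambda>x. a * (real d * (l \<bullet> x + c) ^ (d - 1))"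
    and "D2 \<equiv> \<lambda>x. a * (real d * (real (d - 1) * (l \<bullet> x + c) ^ (d - 2)))"
  shows "quadratic_model (\<lambda>x. a * (l \<bullet> x + c) ^ d) (\<lambda>x. D x *\<^sub>R l) (\<lambda>x. \<chi> i j. D2 x * l $ i * l $ j)"
  unfolding quadratic_model_def
proof (intro conjI allI impI)
  have H: "(\<chi> i j. k * l $ i * l $ j) *v z = (k * (l \<bullet> z)) *\<^sub>R l" for k :: real and z
    by (simp add: vec_eq_iff matrix_vector_mult_def inner_vec_def sum_distrib_left sum_distrib_right mult_ac)
  show "GDERIV (\<lambda>x. a * (l \<bullet> x + c) ^ d) x :> D x *\<^sub>R l" for x
    unfolding gderiv_def D_def
    by (auto intro!: derivative_eq_intros simp: fun_eq_iff inner_commute mult_ac)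
  have "((\<lambda>x. D x) has_derivative (\<lambda>z. D2 x * (l \<bullet> z))) (at x)" for x
    unfolding D_def D2_def
    by (auto intro!: derivative_eq_intros simp: fun_eq_iff mult_ac diff_diff_left numeral_2_eq_2)
  then show "((\<lambda>x. D x *\<^sub>R l) has_derivative (*v) (\<chi> i j. D2 x * l $ i * l $ j)) (at x)" for x
    unfolding H by (rule has_derivative_scaleR_left)
  show "continuous_on UNIV (\<lambda>x. \<chi> i j. D2 x * l $ i * l $ j)"
    unfolding D2_def by (intro continuous_intros)
  fix w :: "real^'n" and \<epsilon> :: real assume "0 < \<epsilon>"
  define \<alpha> where "\<alpha> = l \<bullet> w + c"
  obtain b :: "nat \<Rightarrow> real" where b: "\<And>s. (\<alpha> + s) ^ d = \<alpha> ^ d + real d * \<alpha> ^ (d - 1) * s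
    + real d * real (d - 1) * \<alpha> ^ (d - 2) / 2 * s\<^sup>2 + (\<Sum>j<d. b j * s ^ (j + 3))"
    by (fact power_taylor2)
  define \<epsilon>' where "\<epsilon>' = \<epsilon> / ((norm l)\<^sup>2 + 1)"
  have e: "0 < \<epsilon>'" "\<epsilon>' * (norm l)\<^sup>2 \<le> \<epsilon>"
    using \<open>0 < \<epsilon>\<close> unfolding \<epsilon>'_def by (auto simp: field_simps add_pos_nonneg add_nonneg_pos)
  obtain R0 where R0: "0 < R0" "\<And>R. 0 < R \<and> R \<le> R0 \<Longrightarrow>
    sdp_epigraph (cball 0 R) (\<lambda>s :: real. \<epsilon>' * s\<^sup>2 + (\<Sum>j<d. (- a * b j) * s ^ (j + 3)))"
    using sdp_epigraph_higher_order[OF e(1), where J = d and a = "\<lambda>j. - a * b j"] by meson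
  have lin: "linear (\<lambda>y. l \<bullet> y)" by (simp add: linear_iff inner_add_right)
  show "\<exists>\<rho>0>0. \<forall>\<rho>. 0 < \<rho> \<and> \<rho> \<le> \<rho>0 \<longrightarrow> sdp_epigraph (cball 0 \<rho>) (\<lambda>y. \<epsilon> * (y \<bullet> y)
    + (a * (l \<bullet> w + c) ^ d + D w *\<^sub>R l \<bullet> y + y \<bullet> ((\<chi> i j. D2 w * l $ i * l $ j) *v y) / 2
      - a * (l \<bullet> (w + y) + c) ^ d))"
  proof (intro exI[of _ "R0 / (norm l + 1)"] conjI allI impI)
    show "0 < R0 / (norm l + 1)" using R0(1) by (simp add: add_nonneg_pos)
    fix \<rho> assume \<rho>: "0 < \<rho> \<and> \<rho> \<le> R0 / (norm l + 1)"
    have "sdp_epigraph {y. l \<bullet> y \<in> cball 0 R0} (\<lambda>y. \<epsilon>' * (l \<bullet> y)\<^sup>2 + (\<Sum>j<d. (- a * b j) * (l \<bullet> y) ^ (j + 3)))"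
      using R0 by (intro sdp_epigraph_linear_compose[OF _ lin]) auto
    then have "sdp_epigraph ({y. l \<bullet> y \<in> cball 0 R0} \<inter> UNIV)
      (\<lambda>y. (\<epsilon>' * (l \<bullet> y)\<^sup>2 + (\<Sum>j<d. (- a * b j) * (l \<bullet> y) ^ (j + 3))) + (\<epsilon> * (y \<bullet> y) - \<epsilon>' * (l \<bullet> y)\<^sup>2))"
      by (intro sdp_epigraph_add sdp_epigraph_norm_square) (use e in auto)
    then have "sdp_epigraph (({y. l \<bullet> y \<in> cball 0 R0} \<inter> UNIV) \<inter> cball 0 \<rho>)
      (\<lambda>y. (\<epsilon>' * (l \<bullet> y)\<^sup>2 + (\<Sum>j<d. (- a * b j) * (l \<bullet> y) ^ (j + 3))) + (\<epsilon> * (y \<bullet> y) - \<epsilon>' * (l \<bullet> y)\<^sup>2))"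
      by (rule sdp_epigraph_restrict) (rule sdp_cball)
    moreover have "({y. l \<bullet> y \<in> cball 0 R0} \<inter> UNIV) \<inter> cball 0 \<rho> = cball 0 \<rho>"
    proof -
      have "\<bar>l \<bullet> y\<bar> \<le> R0" if "norm y \<le> \<rho>" for y
      proof -
        have "\<bar>l \<bullet> y\<bar> \<le> norm l * norm y" by (rule Cauchy_Schwarz_ineq2)
        also have "\<dots> \<le> (norm l + 1) * \<rho>" using that by (intro mult_mono) auto
        also have "\<dots> \<le> R0" using \<rho> by (simp add: pos_le_divide_eq add_nonneg_pos mult.commute)
        finally show ?thesis .
      qed
      then show ?thesis by auto
    qed
    moreover have "(\<lambda>y. (\<epsilon>' * (l \<bullet> y)\<^sup>2 + (\<Sum>j<d. (- a * b j) * (l \<bullet> y) ^ (j + 3))) + (\<epsilon> * (y \<bullet> y) - \<epsilon>' * (l \<bullet> y)\<^sup>2))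
      = (\<lambda>y. \<epsilon> * (y \<bullet> y)
    + (a * (l \<bullet> w + c) ^ d + D w *\<^sub>R l \<bullet> y + y \<bullet> ((\<chi> i j. D2 w * l $ i * l $ j) *v y) / 2
      - a * (l \<bullet> (w + y) + c) ^ d))" (is "?L = ?R")
    proof (rule ext)
      fix y
      have "l \<bullet> (w + y) + c = \<alpha> + l \<bullet> y" by (simp add: \<alpha>_def inner_add_right)
      then show "?L y = ?R y"
        unfolding H D_def D2_def \<alpha>_def[symmetric] b inner_scaleR_right inner_scaleR_left
        by (simp only: b sum_distrib_left[symmetric] mult.assoc)
          (simp add: inner_commute power2_eq_square sum_negf sum_distrib_left algebra_simps)
    qed
    ultimately show "sdp_epigraph (cball 0 \<rho>) ?R" by (simp only:)
  qed
qed

lemma gradient_eqI: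
  assumes "GDERIV f x :> D"
  shows "gradient f x = D"
  unfolding gradient_def
proof (rule the_equality)
  fix D' assume "GDERIV f x :> D'"
  then have "(\<lambda>h. h \<bullet> D') = (\<lambda>h. h \<bullet> D)"
    using assms unfolding gderiv_def by (rule has_derivative_unique)
  then have "(D' - D) \<bullet> D' = (D' - D) \<bullet> D" by (rule fun_cong)
  then have "(D' - D) \<bullet> (D' - D) = 0" by (simp add: inner_diff_right)
  then show "D' = D" by simp
qed fact

lemma hessian_eqI:
  assumes "(gradient f has_derivative (\<lambda>z. H *v z)) (at x)"
  shows "hessian f x = H"
  unfolding hessian_def jacobian_def frechet_derivative_at[OF assms, symmetric]
  by (simp add: matrix_of_matrix_vector_mul)

lemma polynomial_quadratic_model:
  fixes f :: "real^'n \<Rightarrow> real"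
  assumes "real_polynomial_function f"
  shows "quadratic_model f (gradient f) (hessian f)"
proof -
  have "power_span f" by (rule real_polynomial_function_power_span) fact
  then have "\<exists>G H. quadratic_model f G H"
  proof (induction rule: power_span.induct)
    case zero
    show ?case using quadratic_model_zero by blast
  next
    case (add_power f a l c d)
    then show ?case using quadratic_model_add[OF quadratic_model_power] by blast
  qed
  then obtain G H where GH: "quadratic_model f G H" by blast
  then have "gradient f = G"
    unfolding quadratic_model_def by (intro ext gradient_eqI) auto
  moreover from this have "hessian f = H"
    using GH unfolding quadratic_model_def by (intro ext hessian_eqI) auto
  ultimately show ?thesis using GH by simp
qed

lemma polynomial_GDERIV: "real_polynomial_function f \<Longrightarrow> GDERIV f x :> gradient f x"
  and polynomial_gradient_derivative:
    "real_polynomial_function f \<Longrightarrow> (gradient f has_derivative (\<lambda>z. hessian f x *v z)) (at x)"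
  and polynomial_continuous_hessian: "real_polynomial_function f \<Longrightarrow> continuous_on UNIV (hessian f)"
  using polynomial_quadratic_model[of f] unfolding quadratic_model_def by auto

lemma real_polynomial_function_lincomb:
  assumes "\<And>i. i \<in> I \<Longrightarrow> real_polynomial_function (p i)"
  shows "real_polynomial_function (\<lambda>x. \<Sum>i\<in>I. \<mu> i * p i x)"
  using assms
  by (induction I rule: infinite_finite_induct)
    (auto intro!: real_polynomial_function.intros(2-4))

lemma gradient_lincomb:
  assumes "\<And>i. i \<in> I \<Longrightarrow> real_polynomial_function (p i)"
  shows "gradient (\<lambda>x. \<Sum>i\<in>I. \<mu> i * p i x) x = (\<Sum>i\<in>I. \<mu> i *\<^sub>R gradient (p i) x)"
proof (rule gradient_eqI)
  have "((\<lambda>x. \<Sum>i\<in>I. \<mu> i * p i x) has_derivative (\<lambda>h. \<Sum>i\<in>I. \<mu> i * (h \<bullet> gradient (p i) x))) (at x)"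
    using polynomial_GDERIV[OF assms] unfolding gderiv_def
    by (intro has_derivative_sum has_derivative_mult_right)
  then show "GDERIV (\<lambda>x. \<Sum>i\<in>I. \<mu> i * p i x) x :> (\<Sum>i\<in>I. \<mu> i *\<^sub>R gradient (p i) x)"
    unfolding gderiv_def by (simp add: inner_sum_right)
qed

lemma matrix_sum_vector_mult: "(\<Sum>i\<in>I. A i) *v z = (\<Sum>i\<in>I. A i *v z)"
  for A :: "'i \<Rightarrow> real^'n^'m"
  by (induction I rule: infinite_finite_induct) (simp_all add: matrix_vector_mult_add_rdistrib)

lemma hessian_lincomb:
  assumes "\<And>i. i \<in> I \<Longrightarrow> real_polynomial_function (p i)"
  shows "hessian (\<lambda>x. \<Sum>i\<in>I. \<mu> i * p i x) x = (\<Sum>i\<in>I. \<mu> i *\<^sub>R hessian (p i) x)"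
proof (rule hessian_eqI)
  have "gradient (\<lambda>x. \<Sum>i\<in>I. \<mu> i * p i x) = (\<lambda>x. \<Sum>i\<in>I. \<mu> i *\<^sub>R gradient (p i) x)"
    by (rule ext) (rule gradient_lincomb[OF assms])
  moreover have "((\<lambda>x. \<Sum>i\<in>I. \<mu> i *\<^sub>R gradient (p i) x) has_derivative
    (\<lambda>z. \<Sum>i\<in>I. \<mu> i *\<^sub>R (hessian (p i) x *v z))) (at x)"
    using polynomial_gradient_derivative[OF assms]
    by (intro has_derivative_sum has_derivative_scaleR_right)
  ultimately show "(gradient (\<lambda>x. \<Sum>i\<in>I. \<mu> i * p i x) has_derivative
    (\<lambda>z. (\<Sum>i\<in>I. \<mu> i *\<^sub>R hessian (p i) x) *v z)) (at x)"
    by (simp add: matrix_sum_vector_mult scaleR_matrix_vector_assoc)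
qed

definition negative_on :: "(real^'n) set \<Rightarrow> (real^'n \<Rightarrow> real) \<Rightarrow> bool" where
  "negative_on B g \<longleftrightarrow> (\<forall>x\<in>B. \<forall>z. z \<noteq> 0 \<longrightarrow> z \<bullet> (hessian g x *v z) < 0)"

lemma quadratic_form_normalize:
  fixes A :: "real^'n^'n"
  shows "z \<bullet> (A *v z) = (norm z)\<^sup>2 * (sgn z \<bullet> (A *v sgn z))"
proof -
  have "z = norm z *\<^sub>R sgn z" by (cases "z = 0") (simp_all add: sgn_div_norm)
  then have "z \<bullet> (A *v z) = (norm z *\<^sub>R sgn z) \<bullet> (A *v (norm z *\<^sub>R sgn z))" by simp
  then show ?thesis by (simp add: matrix_vector_mult_scaleR power2_eq_square)
qed

lemma negative_onI:
  fixes g :: "real^'n \<Rightarrow> real"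
  assumes "\<And>x z. x \<in> B \<Longrightarrow> norm z = 1 \<Longrightarrow> z \<bullet> (hessian g x *v z) < 0"
  shows "negative_on B g"
  unfolding negative_on_def
proof (intro ballI allI impI)
  fix x and z :: "real^'n" assume "x \<in> B" "z \<noteq> 0"
  then have "sgn z \<bullet> (hessian g x *v sgn z) < 0" by (intro assms) (simp_all add: norm_sgn)
  then show "z \<bullet> (hessian g x *v z) < 0"
    using \<open>z \<noteq> 0\<close> quadratic_form_normalize[of z "hessian g x"] by (simp add: mult_pos_neg)
qed

lemma continuous_on_hessian_form:
  fixes p :: "real^'n \<Rightarrow> real"
  assumes "real_polynomial_function p"
  shows "continuous_on S (\<lambda>y. snd y \<bullet> (hessian p (fst y) *v snd y))"
proof -
  have "continuous_on S (\<lambda>y. hessian p (fst y))"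
    by (rule continuous_on_compose2[OF polynomial_continuous_hessian[OF assms] continuous_on_fst[OF continuous_on_id]])
      simp
  then have comp: "continuous_on S (\<lambda>y. hessian p (fst y) $ i $ j)" for i j
    by (intro continuous_on_component)
  have "continuous_on S (\<lambda>y. \<Sum>i\<in>UNIV. snd y $ i * (\<Sum>j\<in>UNIV. hessian p (fst y) $ i $ j * snd y $ j))"
    by (intro continuous_on_sum continuous_on_mult comp
        continuous_on_component[OF continuous_on_snd[OF continuous_on_id]])
  then show ?thesis
    by (simp add: inner_vec_def matrix_vector_mult_def)
qed

lemma negative_on_uniform:
  fixes g :: "real^'n \<Rightarrow> real"
  assumes "compact B" "real_polynomial_function g" "negative_on B g"
  obtains c where "0 < c" "\<And>x z. x \<in> B \<Longrightarrow> z \<bullet> (hessian g x *v z) \<le> - c * (norm z)\<^sup>2"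
proof (cases "B = {}")
  case True
  then show thesis using that[of 1] by simp
next
  case False
  let ?q = "\<lambda>y. snd y \<bullet> (hessian g (fst y) *v snd y)"
  obtain e :: "real^'n" where "norm e = 1" using vector_choose_size[of 1] by auto
  then have "e \<in> sphere 0 1" by simp
  then have ne: "B \<times> sphere (0 :: real^'n) 1 \<noteq> {}" using False by blast
  have cp: "compact (B \<times> sphere (0 :: real^'n) 1)"
    using assms(1) by (intro compact_Times) auto
  obtain m where m: "m \<in> B \<times> sphere 0 1" "\<And>y. y \<in> B \<times> sphere 0 1 \<Longrightarrow> ?q y \<le> ?q m"
    using continuous_attains_sup[OF cp ne continuous_on_hessian_form[OF assms(2)]] by auto
  show thesis
  proof (rule that[of "- ?q m"])
    have "snd m \<noteq> 0" using m(1) by (auto simp: mem_Times_iff)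
    then show "0 < - ?q m" using assms(3) m(1) unfolding negative_on_def by (auto simp: mem_Times_iff)
    fix x and z :: "real^'n" assume "x \<in> B"
    show "z \<bullet> (hessian g x *v z) \<le> - (- ?q m) * (norm z)\<^sup>2"
    proof (cases "z = 0")
      case False
      then have "?q (x, sgn z) \<le> ?q m" using \<open>x \<in> B\<close> by (intro m(2)) (simp add: norm_sgn)
      then have "(norm z)\<^sup>2 * ?q (x, sgn z) \<le> (norm z)\<^sup>2 * ?q m" by (rule mult_left_mono) simp
      then show ?thesis
        using quadratic_form_normalize[of z "hessian g x"] by (simp add: mult.commute)
    qed simp
  qed
qed

lemma negative_on_perturb:
  fixes g p :: "real^'n \<Rightarrow> real"
  assumes "compact B" "real_polynomial_function g" "real_polynomial_function p" "negative_on B g"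
  obtains \<epsilon> where "0 < \<epsilon>" "\<And>t. \<bar>t\<bar> \<le> \<epsilon> \<Longrightarrow> negative_on B (\<lambda>x. g x + t * p x)"
proof -
  obtain c where c: "0 < c" "\<And>x z. x \<in> B \<Longrightarrow> z \<bullet> (hessian g x *v z) \<le> - c * (norm z)\<^sup>2"
    by (fact negative_on_uniform[OF assms(1,2,4)])
  have "bounded ((\<lambda>y. snd y \<bullet> (hessian p (fst y) *v snd y)) ` (B \<times> sphere 0 1))"
    by (intro compact_imp_bounded compact_continuous_image continuous_on_hessian_form compact_Times assms)
      auto
  then obtain K where K: "\<And>x z. x \<in> B \<Longrightarrow> norm z = 1 \<Longrightarrow> \<bar>z \<bullet> (hessian p x *v z)\<bar> \<le> K"
    unfolding bounded_iff by fastforce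
  define \<epsilon> where "\<epsilon> = c / (\<bar>K\<bar> + 1)"
  show thesis
  proof (rule that[of \<epsilon>])
    show "0 < \<epsilon>" using c(1) by (simp add: \<epsilon>_def)
    fix t assume t: "\<bar>t\<bar> \<le> \<epsilon>"
    have H: "hessian (\<lambda>x. g x + t * p x) x = hessian g x + t *\<^sub>R hessian p x" for x
      using hessian_lincomb[of "{True, False}" "\<lambda>b. if b then g else p" "\<lambda>b. if b then 1 else t" x] assms(2,3)
      by simp
    show "negative_on B (\<lambda>x. g x + t * p x)"
    proof (rule negative_onI)
      fix x and z :: "real^'n" assume xz: "x \<in> B" "norm z = 1"
      have "z \<bullet> (hessian g x *v z) \<le> - c" using c(2)[OF xz(1), of z] xz(2) by simp
      moreover have "t * (z \<bullet> (hessian p x *v z)) < c"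
      proof -
        have "t * (z \<bullet> (hessian p x *v z)) \<le> \<bar>t\<bar> * \<bar>z \<bullet> (hessian p x *v z)\<bar>"
          by (metis abs_ge_self abs_mult)
        also have "\<dots> \<le> \<epsilon> * \<bar>K\<bar>"
          using t K[OF xz] \<open>0 < \<epsilon>\<close> by (intro mult_mono) auto
        also have "\<dots> < c" using c(1) by (simp add: \<epsilon>_def field_simps)
        finally show ?thesis .
      qed
      ultimately show "z \<bullet> (hessian (\<lambda>x. g x + t * p x) x *v z) < 0"
        unfolding H matrix_vector_mult_add_rdistrib
        by (simp add: inner_add_right scaleR_matrix_vector_assoc[symmetric])
    qed
  qed
qed

lemma negative_on_tangent:
  fixes g :: "real^'n \<Rightarrow> real"
  assumes "convex B" "real_polynomial_function g" "negative_on B g" "x \<in> B" "v \<in> B" "x \<noteq> v"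
  shows "g x < g v + gradient g v \<bullet> (x - v)"
proof -
  define d where "d = x - v"
  define \<gamma> where "\<gamma> t = v + t *\<^sub>R d" for t
  have inB: "\<gamma> t \<in> B" if "0 \<le> t" "t \<le> 1" for t
    using convexD_alt[OF assms(1,5,4) that] by (simp add: \<gamma>_def d_def algebra_simps)
  have \<gamma>: "(\<gamma> has_derivative (\<lambda>h. h *\<^sub>R d)) (at t)" for t
    unfolding \<gamma>_def by (auto intro!: derivative_eq_intros)
  have d1: "((\<lambda>t. g (\<gamma> t)) has_real_derivative gradient g (\<gamma> t) \<bullet> d) (at t)" for t
  proof -
    have "((\<lambda>t. g (\<gamma> t)) has_derivative (\<lambda>h. (h *\<^sub>R d) \<bullet> gradient g (\<gamma> t))) (at t)"
      using has_derivative_compose[OF \<gamma>] polynomial_GDERIV[OF assms(2)] unfolding gderiv_def by blast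
    then show ?thesis unfolding has_field_derivative_def
      by (rule has_derivative_eq_rhs) (simp add: fun_eq_iff inner_commute mult.commute)
  qed
  have d2: "((\<lambda>t. gradient g (\<gamma> t) \<bullet> d) has_real_derivative d \<bullet> (hessian g (\<gamma> t) *v d)) (at t)" for t
  proof -
    have "((\<lambda>t. gradient g (\<gamma> t)) has_derivative (\<lambda>h. hessian g (\<gamma> t) *v (h *\<^sub>R d))) (at t)"
      using has_derivative_compose[OF \<gamma>] polynomial_gradient_derivative[OF assms(2)] by blast
    then have "((\<lambda>t. gradient g (\<gamma> t) \<bullet> d) has_derivative (\<lambda>h. (hessian g (\<gamma> t) *v (h *\<^sub>R d)) \<bullet> d)) (at t)"
      by (rule has_derivative_inner_left)
    then show ?thesis unfolding has_field_derivative_def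
      by (rule has_derivative_eq_rhs)
        (simp add: fun_eq_iff matrix_vector_mult_scaleR inner_commute mult.commute)
  qed
  obtain t where t: "0 < t" "t < 1" "g (\<gamma> 1) - g (\<gamma> 0) = (1 - 0) * (gradient g (\<gamma> t) \<bullet> d)"
    using MVT2[of 0 1 "\<lambda>t. g (\<gamma> t)" "\<lambda>t. gradient g (\<gamma> t) \<bullet> d"] d1 by auto
  obtain s where s: "0 < s" "s < t"
    "gradient g (\<gamma> t) \<bullet> d - gradient g (\<gamma> 0) \<bullet> d = (t - 0) * (d \<bullet> (hessian g (\<gamma> s) *v d))"
    using MVT2[of 0 t "\<lambda>t. gradient g (\<gamma> t) \<bullet> d" "\<lambda>s. d \<bullet> (hessian g (\<gamma> s) *v d)"] d2 t by auto
  have "\<gamma> s \<in> B" using s t by (intro inB) auto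
  then have "d \<bullet> (hessian g (\<gamma> s) *v d) < 0"
    using assms(3,6) unfolding negative_on_def d_def by auto
  then have "gradient g (\<gamma> t) \<bullet> d < gradient g (\<gamma> 0) \<bullet> d"
    using s t by (smt (verit) mult_pos_neg)
  moreover have "\<gamma> 1 = x" "\<gamma> 0 = v" unfolding \<gamma>_def d_def by auto
  ultimately show ?thesis using t(3) unfolding d_def by simp
qed

lemma sdp_superlevel_near:
  fixes f :: "real^'n \<Rightarrow> real"
  assumes "real_polynomial_function f" "negative_on {w} f"
  obtains \<rho> where "0 < \<rho>" "sdp {x \<in> cball w \<rho>. 0 \<le> f x}"
proof -
  obtain c where c: "0 < c" "\<And>x z. x \<in> {w} \<Longrightarrow> z \<bullet> (hessian f x *v z) \<le> - c * (norm z)\<^sup>2"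
    by (fact negative_on_uniform[OF compact_insert[OF compact_empty] assms])
  define \<epsilon> where "\<epsilon> = c / 2"
  have "0 < \<epsilon>" using c by (simp add: \<epsilon>_def)
  let ?r = "\<lambda>y. \<epsilon> * (y \<bullet> y) + (f w + gradient f w \<bullet> y + y \<bullet> (hessian f w *v y) / 2 - f (w + y))"
  let ?b = "\<lambda>y z. - (y \<bullet> (hessian f w *v z) + z \<bullet> (hessian f w *v y)) / 4 - \<epsilon> * (y \<bullet> z)"
  obtain \<rho> where \<rho>: "0 < \<rho>" "sdp_epigraph (cball 0 \<rho>) ?r"
    using polynomial_quadratic_model[OF assms(1)] \<open>0 < \<epsilon>\<close> unfolding quadratic_model_def by blast
  have b: "sdp_epigraph UNIV (\<lambda>y. ?b y y)"
  proof (rule sdp_epigraph_quadratic[where b = ?b])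
    show "bilinear ?b"
      unfolding bilinear_def linear_iff
      by (simp add: inner_add_left inner_add_right matrix_vector_right_distrib matrix_vector_mult_scaleR
          field_simps)
    show "?b x y = ?b y x" for x y by (simp add: inner_commute[of x y])
    fix x :: "real^'n"
    have "\<epsilon> * (x \<bullet> x) = c * (norm x)\<^sup>2 / 2" by (simp add: \<epsilon>_def power2_norm_eq_inner)
    then show "0 \<le> ?b x x" using c(2)[of w x] by simp
  qed
  have "sdp_epigraph UNIV (\<lambda>y. - f w + - (gradient f w \<bullet> y))"
    by (rule sdp_epigraph_affine) (simp add: linear_iff inner_add_right)
  then have "sdp_epigraph (cball 0 \<rho> \<inter> (UNIV \<inter> UNIV)) (\<lambda>y. ?r y + (?b y y + (- f w + - (gradient f w \<bullet> y))))"
    by (intro sdp_epigraph_add \<rho>(2) b)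
  moreover have "(\<lambda>y. ?r y + (?b y y + (- f w + - (gradient f w \<bullet> y)))) = (\<lambda>y. - f (w + y))"
    by (rule ext) (simp add: field_simps)
  ultimately have "sdp_epigraph (cball 0 \<rho>) (\<lambda>y. - f (w + y))" by simp
  from sdp_sublevel[OF this, of "- w"]
  have "sdp {x. - w + x \<in> cball 0 \<rho> \<and> - f (w + (- w + x)) \<le> 0}" .
  moreover have "{x. - w + x \<in> cball 0 \<rho> \<and> - f (w + (- w + x)) \<le> 0} = {x \<in> cball w \<rho>. 0 \<le> f x}"
    by (auto simp: dist_norm norm_minus_commute)
  ultimately show thesis using that[OF \<rho>(1)] by simp
qed

section \<open>Uniform multipliers\<close>

lemma sdp_convex_hull_superlevel:
  fixes B :: "(real^'n) set" and G :: "(real^'n \<Rightarrow> real) set"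
  assumes "compact B" "sdp B" "finite G"
    and G: "\<And>g. g \<in> G \<Longrightarrow> real_polynomial_function g" "\<And>g. g \<in> G \<Longrightarrow> negative_on B g"
  shows "sdp (convex hull {x \<in> B. \<forall>g\<in>G. 0 \<le> g x})"
proof -
  have "\<forall>y\<in>B \<times> G. \<exists>\<rho>>0. sdp {x \<in> cball (fst y) \<rho>. 0 \<le> snd y x}"
  proof
    fix y assume y: "y \<in> B \<times> G"
    then have "negative_on {fst y} (snd y)" using G(2)[of "snd y"] unfolding negative_on_def by auto
    moreover have "real_polynomial_function (snd y)" using G(1)[of "snd y"] y by auto
    ultimately obtain \<rho> where "0 < \<rho>" "sdp {x \<in> cball (fst y) \<rho>. 0 \<le> snd y x}"
      using sdp_superlevel_near by blast
    then show "\<exists>\<rho>>0. sdp {x \<in> cball (fst y) \<rho>. 0 \<le> snd y x}" by blast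
  qed
  then obtain \<rho> where \<rho>0: "\<forall>y\<in>B \<times> G. 0 < \<rho> y \<and> sdp {x \<in> cball (fst y) (\<rho> y). 0 \<le> snd y x}"
    using bchoice[of "B \<times> G" "\<lambda>y \<rho>. 0 < \<rho> \<and> sdp {x \<in> cball (fst y) \<rho>. 0 \<le> snd y x}"] by blast
  have \<rho>: "0 < \<rho> (w, g) \<and> sdp {x \<in> cball w (\<rho> (w, g)). 0 \<le> g x}" if "w \<in> B" "g \<in> G" for w g
    using bspec[OF \<rho>0, of "(w, g)"] that by simp
  define U where "U w = ball w 1 \<inter> (\<Inter>g\<in>G. ball w (\<rho> (w, g)))" for w
  have U_open: "open (U w)" for w
    unfolding U_def using \<open>finite G\<close> by (intro open_Int open_INT) auto
  have "w \<in> U w" if "w \<in> B" for w unfolding U_def using \<rho> that by auto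
  then have cover: "B \<subseteq> (\<Union>w\<in>B. U w)" by blast
  obtain W where W: "W \<subseteq> B" "finite W" "B \<subseteq> (\<Union>w\<in>W. U w)"
    by (fact compactE_image[OF \<open>compact B\<close> U_open cover])
  define D where "D w = B \<inter> (\<Inter>g\<in>G. {x \<in> cball w (\<rho> (w, g)). 0 \<le> g x})" for w
  have sD: "sdp (D w)" if "w \<in> W" for w
    unfolding D_def using W(1) \<rho> that \<open>sdp B\<close> \<open>finite G\<close> by (intro sdp_Int sdp_INT) auto
  have "sdp (convex hull (\<Union>w\<in>W. D w))"
  proof (rule sdp_convex_hull_UN[OF W(2)])
    fix w assume "w \<in> W"
    then show "sdp (convex hull D w)" using sD sdp_convex[OF sD] by (simp add: hull_same)
    show "bounded (D w)"
      using compact_imp_bounded[OF \<open>compact B\<close>] by (rule bounded_subset) (simp add: D_def)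
  qed
  moreover have "(\<Union>w\<in>W. D w) = {x \<in> B. \<forall>g\<in>G. 0 \<le> g x}"
  proof
    show "(\<Union>w\<in>W. D w) \<subseteq> {x \<in> B. \<forall>g\<in>G. 0 \<le> g x}" unfolding D_def by auto
    show "{x \<in> B. \<forall>g\<in>G. 0 \<le> g x} \<subseteq> (\<Union>w\<in>W. D w)"
    proof
      fix x assume x: "x \<in> {x \<in> B. \<forall>g\<in>G. 0 \<le> g x}"
      then obtain w where "w \<in> W" "x \<in> U w" using W(3) by auto
      then have "x \<in> D w" using x unfolding D_def U_def by (auto intro: less_imp_le)
      then show "x \<in> (\<Union>w\<in>W. D w)" using \<open>w \<in> W\<close> by blast
    qed
  qed
  ultimately show ?thesis by simp
qed

lemma compact_inner_attains_min:
  fixes l :: "'a::euclidean_space"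
  assumes "compact S" "S \<noteq> {}"
  obtains v where "v \<in> S" "\<And>y. y \<in> S \<Longrightarrow> l \<bullet> v \<le> l \<bullet> y"
  using continuous_attains_inf[OF assms continuous_on_inner[OF continuous_on_const continuous_on_id]]
  by blast

lemma sdp_convex_hull_KKT:
  fixes p :: "'i \<Rightarrow> real^'n \<Rightarrow> real" and J :: "'i set" and B :: "(real^'n) set"
  defines "S \<equiv> {x. \<forall>j\<in>J. 0 \<le> p j x}"
    and "comb \<equiv> \<lambda>\<mu> x. \<Sum>j\<in>J. \<mu> j * p j x"
  assumes "finite J" and poly: "\<And>j. j \<in> J \<Longrightarrow> real_polynomial_function (p j)"
    and B: "compact B" "convex B" "sdp B" and SB: "S \<subseteq> B" and S: "compact S"
    and KKT: "\<And>l v. norm l = 1 \<Longrightarrow> v \<in> S \<Longrightarrow> (\<And>x. x \<in> S \<Longrightarrow> l \<bullet> v \<le> l \<bullet> x) \<Longrightarrow>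
      \<exists>\<mu>. (\<forall>j\<in>J. 0 \<le> \<mu> j \<and> \<mu> j * p j v = 0) \<and> gradient (comb \<mu>) v = l \<and> negative_on B (comb \<mu>)"
  shows "sdp (convex hull S)"
proof (cases "\<exists>u. S \<subseteq> {u}")
  case True
  then obtain u where "S = {} \<or> S = {u}" by blast
  then show ?thesis using sdp_empty sdp_cball[of u 0] by auto
next
  case False
  define admissible where "admissible \<mu> \<longleftrightarrow> (\<forall>j\<in>J. 0 \<le> \<mu> j) \<and> negative_on B (comb \<mu>)" for \<mu>
  define supp where "supp \<mu> = {j \<in> J. \<mu> j \<noteq> 0}" for \<mu> :: "'i \<Rightarrow> real"
  define rep where "rep I = (SOME \<mu>. admissible \<mu> \<and> supp \<mu> = I)" for I
  define G where "G = (\<lambda>I. comb (rep I)) ` {I \<in> Pow J. \<exists>\<mu>. admissible \<mu> \<and> supp \<mu> = I}"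
  have rep: "admissible (rep (supp \<mu>)) \<and> supp (rep (supp \<mu>)) = supp \<mu>" if "admissible \<mu>" for \<mu>
    unfolding rep_def by (rule someI[of _ \<mu>]) (simp add: that)
  have poly_comb: "real_polynomial_function (comb \<mu>)" for \<mu>
    unfolding comb_def by (rule real_polynomial_function_lincomb[OF poly])
  have grad_comb: "gradient (comb \<mu>) v = (\<Sum>j\<in>J. \<mu> j *\<^sub>R gradient (p j) v)" for \<mu> v
    unfolding comb_def by (rule gradient_lincomb[OF poly])
  have "finite G" unfolding G_def using \<open>finite J\<close> by auto
  have G_neg: "negative_on B g" if "g \<in> G" for g
    using that rep unfolding G_def admissible_def by auto
  define C where "C = {x \<in> B. \<forall>g\<in>G. 0 \<le> g x}"
  have comb_nonneg: "0 \<le> comb \<mu> x" if "admissible \<mu>" "x \<in> S" for \<mu> x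
    using that unfolding admissible_def comb_def S_def by (auto intro!: sum_nonneg)
  have "S \<subseteq> C"
    using SB comb_nonneg rep unfolding C_def G_def by auto
  have tangent: "comb \<mu> x < gradient (comb \<mu>) v \<bullet> (x - v)"
    if "admissible \<mu>" "\<forall>j\<in>J. \<mu> j * p j v = 0" "v \<in> S" "x \<in> B" "x \<noteq> v" for \<mu> v x
  proof -
    have "comb \<mu> v = 0" unfolding comb_def using that(2) by (rule sum.neutral)
    then show ?thesis
      using negative_on_tangent[OF B(2) poly_comb[of \<mu>], of x v] that SB unfolding admissible_def by auto
  qed
  have key: "0 \<le> l \<bullet> (x - v)" if v: "v \<in> S" and l: "\<And>y. y \<in> S \<Longrightarrow> 0 \<le> l \<bullet> (y - v)" and x: "x \<in> C"
    for v l x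
  proof -
    obtain a where a: "a \<in> S" "a \<noteq> v" using False v by blast
    define e where "e = a - v"
    define N where "N = {l. \<forall>y\<in>S. 0 \<le> l \<bullet> (y - v)}"
    have mult: "\<exists>\<mu>. admissible \<mu> \<and> (\<forall>j\<in>J. \<mu> j * p j v = 0) \<and> gradient (comb \<mu>) v = r"
      if r: "r \<in> N" "r \<noteq> 0" for r
    proof -
      have "sgn r \<bullet> v \<le> sgn r \<bullet> y" if "y \<in> S" for y
        using r that unfolding N_def
        by (auto simp: sgn_div_norm inner_diff_right intro!: mult_left_mono)
      then obtain \<mu> where \<mu>: "\<forall>j\<in>J. 0 \<le> \<mu> j \<and> \<mu> j * p j v = 0" "gradient (comb \<mu>) v = sgn r"
        "negative_on B (comb \<mu>)"
        using KKT[of "sgn r" v] r(2) v by (auto simp: norm_sgn)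
      have sc: "comb (\<lambda>j. norm r * \<mu> j) = (\<lambda>x. \<Sum>j\<in>{()}. norm r * comb \<mu> x)"
        unfolding comb_def by (simp add: sum_distrib_left mult.assoc)
      have "hessian (comb (\<lambda>j. norm r * \<mu> j)) x = norm r *\<^sub>R hessian (comb \<mu>) x" for x
        unfolding sc using hessian_lincomb[of "{()}" "\<lambda>_. comb \<mu>" "\<lambda>_. norm r"] poly_comb by simp
      then have "negative_on B (comb (\<lambda>j. norm r * \<mu> j))"
        using \<mu>(3) r(2) unfolding negative_on_def
        by (simp add: scaleR_matrix_vector_assoc[symmetric] mult_pos_neg)
      moreover have "gradient (comb (\<lambda>j. norm r * \<mu> j)) v = r"
      proof -
        have "gradient (comb (\<lambda>j. norm r * \<mu> j)) v = norm r *\<^sub>R gradient (comb \<mu>) v"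
          unfolding grad_comb by (simp add: scaleR_sum_right)
        then show ?thesis unfolding \<mu>(2) using r(2) by (simp add: sgn_div_norm)
      qed
      ultimately show ?thesis
        using \<mu>(1) unfolding admissible_def by (intro exI[of _ "\<lambda>j. norm r * \<mu> j"]) auto
    qed
    have grad_N: "gradient (comb \<mu>) v \<in> N" "0 < e \<bullet> gradient (comb \<mu>) v"
      if "admissible \<mu>" "\<forall>j\<in>J. \<mu> j * p j v = 0" for \<mu>
    proof -
      show "gradient (comb \<mu>) v \<in> N"
        unfolding N_def
      proof safe
        fix y assume "y \<in> S"
        show "0 \<le> gradient (comb \<mu>) v \<bullet> (y - v)"
        proof (cases "y = v")
          case False
          then show ?thesis
            using tangent[OF that v, of y] comb_nonneg[OF that(1) \<open>y \<in> S\<close>] SB \<open>y \<in> S\<close> by auto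
        qed simp
      qed
      show "0 < e \<bullet> gradient (comb \<mu>) v"
        using tangent[OF that v, of a] comb_nonneg[OF that(1) a(1)] SB a
        unfolding e_def by (auto simp: inner_commute)
    qed
    have e_pos: "0 < e \<bullet> r" if "r \<in> N" "r \<noteq> 0" for r
      using mult[OF that] grad_N(2) by blast
    have scale_N: "k *\<^sub>R r \<in> N" if "r \<in> N" "0 \<le> k" for k r
      using that unfolding N_def by simp
    have "N = (\<Inter>y\<in>S. {l. 0 \<le> (y - v) \<bullet> l})" unfolding N_def by (auto simp: inner_commute)
    then have "closed N"
      by (simp add: closed_INT closed_halfspace_ge)
    define N1 where "N1 = {r \<in> N. e \<bullet> r = 1}"
    have "compact N1"
    proof (rule compact_eq_bounded_closed[THEN iffD2, OF conjI])
      show "closed N1"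
        unfolding N1_def using closed_Int[OF \<open>closed N\<close> closed_hyperplane[of e 1]]
        by (simp add: Int_def)
      show "bounded N1"
      proof (cases "N \<inter> sphere 0 1 = {}")
        case True
        have "N1 = {}"
        proof (rule ccontr)
          assume "N1 \<noteq> {}"
          then obtain r where "r \<in> N" "e \<bullet> r = 1" unfolding N1_def by blast
          then have "sgn r \<in> N" "r \<noteq> 0"
            using scale_N[of r "inverse (norm r)"] by (auto simp: sgn_div_norm)
          then have "sgn r \<in> N \<inter> sphere 0 1" by (simp add: norm_sgn)
          then show False using True by blast
        qed
        then show ?thesis by simp
      next
        case False
        have cp: "compact (N \<inter> sphere 0 1)" by (intro closed_Int_compact \<open>closed N\<close>) simp
        obtain m where m: "m \<in> N \<inter> sphere 0 1" "\<And>r. r \<in> N \<inter> sphere 0 1 \<Longrightarrow> e \<bullet> m \<le> e \<bullet> r"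
          by (fact compact_inner_attains_min[OF cp False])
        then have "0 < e \<bullet> m" by (intro e_pos) auto
        have "norm r \<le> 1 / (e \<bullet> m)" if "r \<in> N1" for r
        proof -
          have r: "r \<in> N" "e \<bullet> r = 1" "r \<noteq> 0" using that unfolding N1_def by auto
          then have "sgn r \<in> N"
            using scale_N[of r "inverse (norm r)"] by (auto simp: sgn_div_norm)
          then have "sgn r \<in> N \<inter> sphere 0 1" using r(3) by (simp add: norm_sgn)
          from m(2)[OF this] have "e \<bullet> m \<le> 1 / norm r"
            using r by (simp add: sgn_div_norm divide_inverse)
          then show ?thesis using r(3) \<open>0 < e \<bullet> m\<close> by (simp add: field_simps)
        qed
        then show ?thesis unfolding bounded_iff by blast
      qed
    qed
    moreover have "convex N1"
      unfolding N1_def N_def convex_def by (auto simp: inner_add_left inner_add_right)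
    ultimately have KM: "N1 = convex hull {r. r extreme_point_of N1}"
      by (rule Krein_Milman_Minkowski)
    have extreme: "0 \<le> r \<bullet> (x - v)" if ext: "r extreme_point_of N1" for r
    proof -
      have r: "r \<in> N" "e \<bullet> r = 1" using ext unfolding extreme_point_of_def N1_def by auto
      then have "r \<noteq> 0" by auto
      obtain \<mu> where \<mu>: "admissible \<mu>" "\<forall>j\<in>J. \<mu> j * p j v = 0" "gradient (comb \<mu>) v = r"
        using mult[OF r(1) \<open>r \<noteq> 0\<close>] by blast
      have parallel: "gradient (p j) v = (e \<bullet> gradient (p j) v) *\<^sub>R r" if j: "j \<in> supp \<mu>" for j
      proof -
        define w where "w = gradient (p j) v"
        have "j \<in> J" "\<mu> j \<noteq> 0" using j unfolding supp_def by auto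
        then have "0 < \<mu> j" "p j v = 0" using \<mu>(1,2) unfolding admissible_def by force+
        obtain \<epsilon>1 where \<epsilon>1: "0 < \<epsilon>1" "\<And>t. \<bar>t\<bar> \<le> \<epsilon>1 \<Longrightarrow> negative_on B (\<lambda>x. comb \<mu> x + t * p j x)"
          using negative_on_perturb[OF B(1) poly_comb poly[OF \<open>j \<in> J\<close>]] \<mu>(1)
          unfolding admissible_def by metis
        define \<epsilon> where "\<epsilon> = min \<epsilon>1 (\<mu> j)"
        have "0 < \<epsilon>" using \<epsilon>1(1) \<open>0 < \<mu> j\<close> by (simp add: \<epsilon>_def)
        have pert: "r + t *\<^sub>R w \<in> N \<and> 0 < e \<bullet> (r + t *\<^sub>R w)" if t: "\<bar>t\<bar> \<le> \<epsilon>" for t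
        proof -
          define \<nu> where "\<nu> = \<mu>(j := \<mu> j + t)"
          have c: "comb \<nu> = (\<lambda>x. comb \<mu> x + t * p j x)"
            unfolding comb_def \<nu>_def
            using \<open>finite J\<close> \<open>j \<in> J\<close> by (simp add: fun_eq_iff sum.remove[of J j] algebra_simps)
          have "gradient (comb \<nu>) v = r + t *\<^sub>R w"
            unfolding grad_comb \<mu>(3)[symmetric] w_def \<nu>_def
            using \<open>finite J\<close> \<open>j \<in> J\<close> by (simp add: sum.remove[of J j] algebra_simps)
          moreover have "admissible \<nu>"
            unfolding admissible_def c using \<mu>(1) t \<epsilon>1(2)[of t]
            unfolding admissible_def \<nu>_def \<epsilon>_def by auto
          moreover have "\<forall>j\<in>J. \<nu> j * p j v = 0"
            using \<mu>(2) \<open>p j v = 0\<close> unfolding \<nu>_def by auto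
          ultimately show ?thesis using grad_N[of \<nu>] by simp
        qed
        define \<alpha> where "\<alpha> = 1 + \<epsilon> * (e \<bullet> w)"
        define \<beta> where "\<beta> = 1 - \<epsilon> * (e \<bullet> w)"
        have ab: "0 < \<alpha>" "0 < \<beta>" "\<alpha> + \<beta> = 2"
          using pert[of \<epsilon>] pert[of "- \<epsilon>"] \<open>0 < \<epsilon>\<close> r(2)
          unfolding \<alpha>_def \<beta>_def by (auto simp: inner_add_right inner_diff_right)
        define q where "q = (1 / \<alpha>) *\<^sub>R (r + \<epsilon> *\<^sub>R w)"
        define q' where "q' = (1 / \<beta>) *\<^sub>R (r + (- \<epsilon>) *\<^sub>R w)"
        have "q \<in> N1" "q' \<in> N1"
          unfolding N1_def q_def q'_def
          using pert[of \<epsilon>] pert[of "- \<epsilon>"] \<open>0 < \<epsilon>\<close> ab r(2)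
          by (auto intro!: scale_N simp: inner_add_right inner_diff_right \<alpha>_def \<beta>_def)
        have comb_r: "r = (1 - \<beta> / 2) *\<^sub>R q + (\<beta> / 2) *\<^sub>R q'"
        proof -
          have "1 - \<beta> / 2 = \<alpha> / 2" using ab(3) by simp
          then have "(1 - \<beta> / 2) *\<^sub>R q + (\<beta> / 2) *\<^sub>R q' = (1 / 2) *\<^sub>R (r + \<epsilon> *\<^sub>R w) + (1 / 2) *\<^sub>R (r + (- \<epsilon>) *\<^sub>R w)"
            using ab(1,2) by (simp add: q_def q'_def)
          also have "\<dots> = (1 / 2 + 1 / 2) *\<^sub>R r"
            by (simp only: scaleR_add_right scaleR_add_left) simp
          finally show ?thesis by simp
        qed
        have "q = q'"
        proof (rule ccontr)
          assume "q \<noteq> q'"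
          then have "r \<in> open_segment q q'"
            unfolding in_segment using comb_r ab by (intro conjI exI[of _ "\<beta> / 2"]) auto
          then show False using ext \<open>q \<in> N1\<close> \<open>q' \<in> N1\<close> unfolding extreme_point_of_def by blast
        qed
        then have "r = q" using comb_r by (simp add: scaleR_left_distrib[symmetric])
        moreover have "\<alpha> *\<^sub>R q = r + \<epsilon> *\<^sub>R w" using ab(1) by (simp add: q_def)
        ultimately have "\<alpha> *\<^sub>R r = r + \<epsilon> *\<^sub>R w" by (simp only:)
        then have "\<epsilon> *\<^sub>R w = \<epsilon> *\<^sub>R ((e \<bullet> w) *\<^sub>R r)" by (simp add: \<alpha>_def scaleR_left_distrib)
        then show ?thesis
          using \<open>0 < \<epsilon>\<close> unfolding w_def scaleR_cancel_left by (auto simp del: scaleR_scaleR)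
      qed
      define \<nu> where "\<nu> = rep (supp \<mu>)"
      have \<nu>: "admissible \<nu>" "supp \<nu> = supp \<mu>" using rep[OF \<mu>(1)] unfolding \<nu>_def by auto
      have "comb \<nu> \<in> G" unfolding G_def \<nu>_def using \<mu>(1) by (auto simp: supp_def)
      have \<nu>0: "\<forall>j\<in>J. \<nu> j * p j v = 0"
        using \<mu>(2) \<nu>(2) unfolding supp_def by auto
      define \<kappa> where "\<kappa> = (\<Sum>j\<in>J. \<nu> j * (e \<bullet> gradient (p j) v))"
      have "\<nu> j *\<^sub>R gradient (p j) v = (\<nu> j * (e \<bullet> gradient (p j) v)) *\<^sub>R r" if "j \<in> J" for j
      proof (cases "j \<in> supp \<mu>")
        case True
        then show ?thesis using parallel[OF True] by (metis scaleR_scaleR)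
      next
        case False
        then have "\<nu> j = 0" using \<nu>(2) that unfolding supp_def by blast
        then show ?thesis by simp
      qed
      then have grad: "gradient (comb \<nu>) v = \<kappa> *\<^sub>R r"
        unfolding grad_comb \<kappa>_def scaleR_sum_left by (intro sum.cong refl) auto
      have "0 < \<kappa>" using grad_N(2)[OF \<nu>(1) \<nu>0] r(2) unfolding grad by simp
      show ?thesis
      proof (cases "x = v")
        case False
        have "0 \<le> comb \<nu> x" using x \<open>comb \<nu> \<in> G\<close> unfolding C_def by auto
        also have "\<dots> < \<kappa> * (r \<bullet> (x - v))"
          using tangent[OF \<nu>(1) \<nu>0 v _ False] x unfolding grad C_def by simp
        finally show ?thesis using \<open>0 < \<kappa>\<close> by (simp add: zero_less_mult_iff)
      qed simp
    qed
    have "convex hull {r. r extreme_point_of N1} \<subseteq> {r. 0 \<le> (x - v) \<bullet> r}"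
    proof (rule hull_minimal)
      show "convex {r. 0 \<le> (x - v) \<bullet> r}" by (rule convex_halfspace_ge)
    qed (use extreme in \<open>auto simp: inner_commute\<close>)
    then have N1: "0 \<le> r \<bullet> (x - v)" if "r \<in> N1" for r
      using that KM by (auto simp: inner_commute)
    show ?thesis
    proof (cases "l = 0")
      case False
      have "l \<in> N" using l unfolding N_def by simp
      then have pos: "0 < e \<bullet> l" using e_pos False by blast
      then have "(1 / (e \<bullet> l)) *\<^sub>R l \<in> N1"
        unfolding N1_def using scale_N[OF \<open>l \<in> N\<close>] by simp
      from N1[OF this] show ?thesis using pos by (simp add: zero_le_divide_iff)
    qed simp
  qed
  have "C \<subseteq> convex hull S"
  proof
    fix x assume x: "x \<in> C"
    show "x \<in> convex hull S"
    proof (rule ccontr)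
      assume nx: "x \<notin> convex hull S"
      obtain l b where lb: "l \<bullet> x < b" "\<And>y. y \<in> convex hull S \<Longrightarrow> b < l \<bullet> y"
        using separating_hyperplane_closed_point[OF convex_convex_hull _ nx]
          compact_imp_closed[OF compact_convex_hull[OF S]] by blast
      have "S \<noteq> {}" using False by blast
      obtain v where v: "v \<in> S" "\<And>y. y \<in> S \<Longrightarrow> l \<bullet> v \<le> l \<bullet> y"
        by (fact compact_inner_attains_min[OF S \<open>S \<noteq> {}\<close>])
      have "0 \<le> l \<bullet> (x - v)" using v by (intro key[OF v(1) _ x]) (auto simp: inner_diff_right)
      moreover have "b < l \<bullet> v" using lb(2) v(1) hull_subset[of S convex] by blast
      ultimately show False using lb(1) by (simp add: inner_diff_right)
    qed
  qed
  have "convex hull C = convex hull S"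
    using \<open>S \<subseteq> C\<close> \<open>C \<subseteq> convex hull S\<close>
    by (meson convex_convex_hull hull_minimal hull_mono subset_antisym)
  moreover have "sdp (convex hull C)"
    unfolding C_def using G_neg \<open>finite G\<close> B
    by (intro sdp_convex_hull_superlevel) (auto simp: G_def poly_comb)
  ultimately show ?thesis by simp
qed

section \<open>The PDLH condition\<close>

lemma real_polynomial_function_ball:
  fixes u :: "real^'n"
  shows "real_polynomial_function (\<lambda>x. r\<^sup>2 - (norm (x - u))\<^sup>2)"
proof -
  have c: "real_polynomial_function (\<lambda>x. (x - u) $ i)" for i
  proof -
    have "real_polynomial_function (\<lambda>x. x $ i + - (u $ i))"
      by (intro real_polynomial_function.intros(1,2,3) bounded_linear_vec_nth)
    then show ?thesis by simp
  qed
  have "real_polynomial_function (\<lambda>x. \<Sum>i\<in>UNIV. (-1) * ((x - u) $ i * (x - u) $ i))"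
    by (rule real_polynomial_function_lincomb) (intro real_polynomial_function.intros(4) c)
  then have "real_polynomial_function (\<lambda>x. r\<^sup>2 + (\<Sum>i\<in>UNIV. (-1) * ((x - u) $ i * (x - u) $ i)))"
    by (intro real_polynomial_function.intros(2,3))
  moreover have "(\<Sum>i\<in>UNIV. (-1) * ((x - u) $ i * (x - u) $ i)) = - (norm (x - u))\<^sup>2" for x
    by (simp add: power2_norm_eq_inner inner_vec_def sum_negf)
  ultimately show ?thesis by simp
qed

lemma sdp_convex_hull_PDLH:
  fixes f h :: "nat \<Rightarrow> real^'n \<Rightarrow> real"
  assumes f: "\<And>i. i \<in> {1..m1} \<Longrightarrow> real_polynomial_function (f i)"
    and h: "\<And>j. j \<in> {1..m2} \<Longrightarrow> real_polynomial_function (h j)"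
    and "PDLH_at m1 f m2 h u"
  obtains \<delta> where "0 < \<delta>" "sdp (convex hull (basic_closed m1 f m2 h \<inter> cball u \<delta>))"
proof -
  define m where "m = m2 + 1"
  obtain \<delta> where "0 < \<delta>" and pdlh0: "\<forall>l \<delta>'. norm l = 1 \<and> 0 < \<delta>' \<and> \<delta>' \<le> \<delta> \<longrightarrow>
      (let m = m2 + 1; g = h(m := \<lambda>x. \<delta>'\<^sup>2 - (norm (x - u))\<^sup>2) in
       \<forall>v. is_arg_min (\<lambda>x. l \<bullet> x) (\<lambda>x. x \<in> basic_closed m1 f m g) v \<longrightarrow>
         (\<exists>(lam :: nat \<Rightarrow> real) (\<mu> :: nat \<Rightarrow> real).
            (\<forall>j\<in>{1..m}. 0 \<le> \<mu> j) \<and>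
            l = (\<Sum>i=1..m1. lam i *\<^sub>R gradient (f i) v) + (\<Sum>j=1..m. \<mu> j *\<^sub>R gradient (g j) v) \<and>
            (\<forall>j\<in>{1..m}. \<mu> j * g j v = 0) \<and>
            (\<forall>x. norm (x - u) \<le> \<delta>' \<longrightarrow>
               positive_definite
                 (- (\<Sum>i=1..m1. lam i *\<^sub>R hessian (f i) x)
                  - (\<Sum>j=1..m. \<mu> j *\<^sub>R hessian (g j) x)))))"
    using assms(3) unfolding PDLH_at_def by blast
  define g where "g = h(m := \<lambda>x. \<delta>\<^sup>2 - (norm (x - u))\<^sup>2)"
  have pdlh: "\<exists>(lam :: nat \<Rightarrow> real) (\<mu> :: nat \<Rightarrow> real).
            (\<forall>j\<in>{1..m}. 0 \<le> \<mu> j) \<and>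
            l = (\<Sum>i=1..m1. lam i *\<^sub>R gradient (f i) v) + (\<Sum>j=1..m. \<mu> j *\<^sub>R gradient (g j) v) \<and>
            (\<forall>j\<in>{1..m}. \<mu> j * g j v = 0) \<and>
            (\<forall>x. norm (x - u) \<le> \<delta> \<longrightarrow>
               positive_definite
                 (- (\<Sum>i=1..m1. lam i *\<^sub>R hessian (f i) x)
                  - (\<Sum>j=1..m. \<mu> j *\<^sub>R hessian (g j) x)))"
    if "norm l = 1" "is_arg_min (\<lambda>x. l \<bullet> x) (\<lambda>x. x \<in> basic_closed m1 f m g) v" for l v
    using pdlh0[rule_format, of l \<delta>] that \<open>0 < \<delta>\<close> unfolding Let_def m_def[symmetric] g_def[symmetric]
    by blast
  have g: "real_polynomial_function (g j)" if "j \<in> {1..m}" for j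
  proof (cases "j = m")
    case True
    then show ?thesis unfolding g_def using real_polynomial_function_ball by simp
  next
    case False
    then have "j \<in> {1..m2}" using that unfolding m_def by auto
    then show ?thesis using False h by (simp add: g_def)
  qed
  define S where "S = basic_closed m1 f m2 h \<inter> cball u \<delta>"
  have gm: "0 \<le> g m x \<longleftrightarrow> x \<in> cball u \<delta>" for x
    using \<open>0 < \<delta>\<close>
    by (simp add: g_def dist_norm norm_minus_commute[of u] power2_le_iff_abs_le)
  have S_eq: "S = basic_closed m1 f m g"
  proof -
    have "{1..m} = insert m {1..m2}" unfolding m_def by auto
    moreover have "g j = h j" if "j \<in> {1..m2}" for j using that unfolding g_def m_def by auto
    ultimately show ?thesis using gm unfolding S_def basic_closed_def by auto
  qed
  define J where "J = ({1..m1} \<times> (UNIV :: bool set)) <+> {1..m}"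
  define p where "p = case_sum (\<lambda>(i, b) x. (if b then 1 else -1) * f i x) g"
  have J: "finite J" unfolding J_def by auto
  have p_poly: "real_polynomial_function (p j)" if "j \<in> J" for j
  proof (cases j)
    case (Inl ib)
    then have "real_polynomial_function (f (fst ib))" using that f unfolding J_def by auto
    then have "real_polynomial_function (\<lambda>x. (if snd ib then 1 else -1) * f (fst ib) x)"
      by (intro real_polynomial_function.intros(2,4))
    then show ?thesis unfolding p_def Inl by (simp only: sum.case split_def)
  next
    case (Inr i)
    then show ?thesis using that g unfolding J_def p_def by auto
  qed
  have S_p: "S = {x. \<forall>j\<in>J. 0 \<le> p j x}"
  proof -
    have "(\<forall>j\<in>J. 0 \<le> p j x) \<longleftrightarrow> (\<forall>i\<in>{1..m1}. f i x = 0) \<and> (\<forall>j\<in>{1..m}. 0 \<le> g j x)" for x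
      unfolding J_def p_def by (auto simp: Plus_def ball_Un all_bool_eq split_def intro: antisym)
    then show ?thesis unfolding S_eq basic_closed_def by auto
  qed
  have S_closed: "closed S"
  proof -
    have "closed {x. 0 \<le> p j x}" if "j \<in> J" for j
      using p_poly[OF that]
      by (intro closed_Collect_le continuous_on_const continuous_on_polymonial_function)
        (simp add: real_polynomial_function_eq)
    then have "closed (\<Inter>j\<in>J. {x. 0 \<le> p j x})" by (intro closed_INT) auto
    moreover have "S = (\<Inter>j\<in>J. {x. 0 \<le> p j x})" unfolding S_p by auto
    ultimately show ?thesis by simp
  qed
  have "sdp (convex hull {x. \<forall>j\<in>J. 0 \<le> p j x})"
  proof (rule sdp_convex_hull_KKT[OF J p_poly, where B = "cball u \<delta>"])
    show "{x. \<forall>j\<in>J. 0 \<le> p j x} \<subseteq> cball u \<delta>" unfolding S_p[symmetric] S_def by auto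
    have "S = S \<inter> cball u \<delta>" unfolding S_def by auto
    then have "compact S" using closed_Int_compact[OF S_closed compact_cball[of u \<delta>]] by simp
    then show "compact {x. \<forall>j\<in>J. 0 \<le> p j x}" unfolding S_p .
    fix l v assume l: "norm l = 1" and v: "v \<in> {x. \<forall>j\<in>J. 0 \<le> p j x}"
      and min: "\<And>x. x \<in> {x. \<forall>j\<in>J. 0 \<le> p j x} \<Longrightarrow> l \<bullet> v \<le> l \<bullet> x"
    have vS: "v \<in> S" using v unfolding S_p .
    have "is_arg_min (\<lambda>x. l \<bullet> x) (\<lambda>x. x \<in> basic_closed m1 f m g) v"
      using v min unfolding is_arg_min_def S_p[symmetric] S_eq[symmetric] by (auto simp: not_less)
    from pdlh[OF l this] obtain lam \<mu> :: "nat \<Rightarrow> real" where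
      \<mu>: "\<forall>j\<in>{1..m}. 0 \<le> \<mu> j" "\<forall>j\<in>{1..m}. \<mu> j * g j v = 0"
      and leq: "l = (\<Sum>i=1..m1. lam i *\<^sub>R gradient (f i) v) + (\<Sum>j=1..m. \<mu> j *\<^sub>R gradient (g j) v)"
      and pd: "\<And>x. norm (x - u) \<le> \<delta> \<Longrightarrow> positive_definite
                 (- (\<Sum>i=1..m1. lam i *\<^sub>R hessian (f i) x)
                  - (\<Sum>j=1..m. \<mu> j *\<^sub>R hessian (g j) x))" by blast
    let ?K = "{1..m1} <+> {1..m}" and ?q = "case_sum f g" and ?c = "case_sum lam \<mu>"
    define \<nu> where "\<nu> = case_sum (\<lambda>(i, b). if b then max (lam i) 0 else max (- lam i) 0) \<mu>"
    have q: "real_polynomial_function (?q k)" if "k \<in> ?K" for k using that f g by auto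
    have comb: "(\<lambda>x. \<Sum>j\<in>J. \<nu> j * p j x) = (\<lambda>x. \<Sum>k\<in>?K. ?c k * ?q k x)"
    proof (rule ext)
      fix x
      have "max (lam i) 0 * f i x + max (- lam i) 0 * (- f i x) = lam i * f i x" for i
        by (simp add: max_def)
      moreover have "(\<Sum>ib\<in>{1..m1} \<times> UNIV. \<nu> (Inl ib) * p (Inl ib) x)
        = (\<Sum>i=1..m1. \<Sum>b\<in>UNIV. \<nu> (Inl (i, b)) * p (Inl (i, b)) x)"
        by (simp add: sum.cartesian_product split_def)
      ultimately show "(\<Sum>j\<in>J. \<nu> j * p j x) = (\<Sum>k\<in>?K. ?c k * ?q k x)"
        unfolding J_def by (simp add: sum.Plus UNIV_bool \<nu>_def p_def add.commute)
    qed
    have "\<forall>j\<in>J. 0 \<le> \<nu> j \<and> \<nu> j * p j v = 0"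
    proof
      fix j assume "j \<in> J"
      then show "0 \<le> \<nu> j \<and> \<nu> j * p j v = 0"
        using \<mu> vS unfolding J_def \<nu>_def p_def S_eq basic_closed_def by (auto split: sum.splits)
    qed
    moreover have "gradient (\<lambda>x. \<Sum>j\<in>J. \<nu> j * p j x) v = l"
    proof -
      have "gradient (\<lambda>x. \<Sum>k\<in>?K. ?c k * ?q k x) v = (\<Sum>k\<in>?K. ?c k *\<^sub>R gradient (?q k) v)"
        by (rule gradient_lincomb) (rule q)
      then show ?thesis unfolding comb leq by (simp add: sum.Plus)
    qed
    moreover have "negative_on (cball u \<delta>) (\<lambda>x. \<Sum>j\<in>J. \<nu> j * p j x)"
      unfolding negative_on_def
    proof (intro ballI allI impI)
      fix x and z :: "real^'n" assume x: "x \<in> cball u \<delta>" and z: "z \<noteq> 0"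
      let ?A = "(\<Sum>i=1..m1. lam i *\<^sub>R hessian (f i) x)" and ?B = "(\<Sum>j=1..m. \<mu> j *\<^sub>R hessian (g j) x)"
      have "hessian (\<lambda>x. \<Sum>j\<in>J. \<nu> j * p j x) x = ?A + ?B"
      proof -
        have "hessian (\<lambda>x. \<Sum>k\<in>?K. ?c k * ?q k x) x = (\<Sum>k\<in>?K. ?c k *\<^sub>R hessian (?q k) x)"
          by (rule hessian_lincomb) (rule q)
        then show ?thesis unfolding comb by (simp add: sum.Plus)
      qed
      moreover have "0 < z \<bullet> ((- ?A - ?B) *v z)"
        using pd[of x] x z unfolding positive_definite_def
        by (simp add: dist_norm norm_minus_commute)
      moreover have "(- ?A - ?B) *v z = - ((?A + ?B) *v z)"
      proof -
        have "(- ?A - ?B) *v z = (0 - (?A + ?B)) *v z" by simp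
        then show ?thesis by (simp only: matrix_vector_mult_diff_rdistrib) simp
      qed
      ultimately show "z \<bullet> (hessian (\<lambda>x. \<Sum>j\<in>J. \<nu> j * p j x) x *v z) < 0" by simp
    qed
    ultimately show "\<exists>\<mu>. (\<forall>j\<in>J. 0 \<le> \<mu> j \<and> \<mu> j * p j v = 0) \<and>
        gradient (\<lambda>x. \<Sum>j\<in>J. \<mu> j * p j x) v = l \<and> negative_on (cball u \<delta>) (\<lambda>x. \<Sum>j\<in>J. \<mu> j * p j x)"
      by blast
  qed (auto intro: sdp_cball)
  then show thesis using that[OF \<open>0 < \<delta>\<close>] unfolding S_p[symmetric] S_def by blast
qed

lemma compact_convex_boundary:
  assumes "compact T"
  shows "compact (convex_boundary T)"
proof -
  have "closed {p. \<forall>x\<in>T. snd p \<bullet> fst p \<le> snd p \<bullet> x}"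
  proof -
    have "{p. \<forall>x\<in>T. snd p \<bullet> fst p \<le> snd p \<bullet> x} = (\<Inter>x\<in>T. {p. snd p \<bullet> fst p \<le> snd p \<bullet> x})" by auto
    then show ?thesis by (simp only:) (intro closed_INT ballI closed_Collect_le continuous_intros)
  qed
  then have "compact ((T \<times> sphere 0 1) \<inter> {p. \<forall>x\<in>T. snd p \<bullet> fst p \<le> snd p \<bullet> x})"
    using assms by (intro compact_Int_closed compact_Times) auto
  then have "compact (fst ` ((T \<times> sphere 0 1) \<inter> {p. \<forall>x\<in>T. snd p \<bullet> fst p \<le> snd p \<bullet> x}))"
    by (intro compact_continuous_image continuous_intros)
  moreover have "fst ` ((T \<times> sphere 0 1) \<inter> {p. \<forall>x\<in>T. snd p \<bullet> fst p \<le> snd p \<bullet> x}) = convex_boundary T"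
    unfolding convex_boundary_def is_arg_min_def by (force simp: not_less image_iff)
  ultimately show ?thesis by simp
qed

lemma convex_boundary_not_interior:
  assumes "u \<in> convex_boundary T" "S \<subseteq> T"
  shows "u \<notin> interior S"
proof
  assume "u \<in> interior S"
  then obtain e where e: "0 < e" "cball u e \<subseteq> S" using mem_interior_cball by blast
  obtain l where l: "norm l = 1" "\<And>x. x \<in> T \<Longrightarrow> l \<bullet> u \<le> l \<bullet> x"
    using assms(1) unfolding convex_boundary_def is_arg_min_def by (auto simp: not_less)
  have "u - e *\<^sub>R l \<in> cball u e" using e(1) l(1) by (simp add: dist_norm)
  then have "l \<bullet> u \<le> l \<bullet> (u - e *\<^sub>R l)" using e(2) assms(2) by (intro l(2)) blast
  moreover have "l \<bullet> l = 1" using l(1) by (simp add: dot_square_norm)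
  ultimately show False using e(1) by (simp add: inner_diff_right)
qed

lemma convex_hull_subset_if_convex_boundary:
  assumes "compact T" "convex_boundary T \<subseteq> K" "convex K" "closed K"
  shows "convex hull T \<subseteq> K"
proof (rule hull_minimal)
  show "T \<subseteq> K"
  proof
    fix x assume x: "x \<in> T"
    then have ne: "T \<noteq> {}" by blast
    show "x \<in> K"
    proof (rule ccontr)
      assume "x \<notin> K"
      then obtain a b where ab: "a \<bullet> x < b" "\<And>y. y \<in> K \<Longrightarrow> b < a \<bullet> y"
        using separating_hyperplane_closed_point[OF assms(3,4)] by blast
      obtain v where v: "v \<in> T" "\<And>y. y \<in> T \<Longrightarrow> a \<bullet> v \<le> a \<bullet> y"
        by (fact compact_inner_attains_min[OF assms(1) ne])
      have "a \<noteq> 0"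
      proof
        assume "a = 0"
        obtain l :: "real^'a" where "norm l = 1" using vector_choose_size[of 1] by auto
        moreover obtain w where "w \<in> T" "\<And>y. y \<in> T \<Longrightarrow> l \<bullet> w \<le> l \<bullet> y"
          by (fact compact_inner_attains_min[OF assms(1) ne])
        ultimately have "w \<in> convex_boundary T"
          unfolding convex_boundary_def is_arg_min_def by (auto simp: not_less)
        then show False using ab \<open>a = 0\<close> assms(2) by force
      qed
      have "sgn a \<bullet> v \<le> sgn a \<bullet> y" if "y \<in> T" for y
        using v(2)[OF that] by (simp add: sgn_div_norm mult_left_mono)
      then have "v \<in> convex_boundary T"
        using v(1) \<open>a \<noteq> 0\<close> unfolding convex_boundary_def is_arg_min_def
        by (auto simp: not_less norm_sgn intro!: exI[of _ "sgn a"])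
      then have "b < a \<bullet> v" using ab(2) assms(2) by blast
      then show False using v(2)[OF x] ab(1) by simp
    qed
  qed
qed fact

theorem theorem4p8:
  fixes L :: nat
    and m1 m2 :: "nat \<Rightarrow> nat"
    and f h :: "nat \<Rightarrow> nat \<Rightarrow> real^'n \<Rightarrow> real"
    and Tk :: "nat \<Rightarrow> (real^'n) set"
    and T :: "(real^'n) set"
  assumes f_poly: "\<And>k i. k \<in> {1..L} \<Longrightarrow> i \<in> {1..m1 k} \<Longrightarrow> real_polynomial_function (f k i)"
    and h_poly: "\<And>k j. k \<in> {1..L} \<Longrightarrow> j \<in> {1..m2 k} \<Longrightarrow> real_polynomial_function (h k j)"
    and Tk_eq: "\<And>k. k \<in> {1..L} \<Longrightarrow> Tk k = basic_closed (m1 k) (f k) (m2 k) (h k)"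
    and T_eq: "T = (\<Union>k\<in>{1..L}. Tk k)"
    and T_compact: "compact T"
    and PDLH: "\<And>k u. k \<in> {1..L} \<Longrightarrow> u \<in> convex_boundary T \<inter> frontier (Tk k) \<Longrightarrow>
                 PDLH_at (m1 k) (f k) (m2 k) (h k) u"
  shows "SDP_representable (convex hull T)"
proof -
  have Tk_closed: "closed (Tk k)" if k: "k \<in> {1..L}" for k
  proof -
    have cont: "continuous_on UNIV (f k i)" if "i \<in> {1..m1 k}" for i
      using f_poly[OF k that] by (intro continuous_on_polymonial_function) (simp add: real_polynomial_function_eq)
    have cont': "continuous_on UNIV (h k j)" if "j \<in> {1..m2 k}" for j
      using h_poly[OF k that] by (intro continuous_on_polymonial_function) (simp add: real_polynomial_function_eq)
    have "Tk k = (\<Inter>i\<in>{1..m1 k}. {x. f k i x = 0}) \<inter> (\<Inter>j\<in>{1..m2 k}. {x. 0 \<le> h k j x})"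
      unfolding Tk_eq[OF k] basic_closed_def by auto
    moreover have "closed \<dots>"
      by (intro closed_Int closed_INT ballI closed_Collect_eq closed_Collect_le continuous_on_const cont cont')
    ultimately show ?thesis by simp
  qed
  define X where "X k = convex_boundary T \<inter> Tk k" for k
  have X_compact: "compact (X k)" if "k \<in> {1..L}" for k
    unfolding X_def by (intro compact_Int_closed compact_convex_boundary T_compact Tk_closed that)
  have local: "\<exists>\<delta>>0. sdp (convex hull (Tk k \<inter> cball u \<delta>))" if k: "k \<in> {1..L}" and u: "u \<in> X k" for k u
  proof -
    have "Tk k \<subseteq> T" unfolding T_eq using k by blast
    then have "u \<notin> interior (Tk k)" using u convex_boundary_not_interior unfolding X_def by blast
    then have "u \<in> frontier (Tk k)"
      using u closure_subset unfolding frontier_def X_def by blast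
    then have "PDLH_at (m1 k) (f k) (m2 k) (h k) u" using u unfolding X_def by (intro PDLH k) auto
    from sdp_convex_hull_PDLH[OF f_poly[OF k] h_poly[OF k] this] show ?thesis
      unfolding Tk_eq[OF k] by blast
  qed
  then have "\<forall>y\<in>Sigma {1..L} X. \<exists>\<delta>>0. sdp (convex hull (Tk (fst y) \<inter> cball (snd y) \<delta>))" by auto
  then obtain \<delta> where \<delta>0: "\<forall>y\<in>Sigma {1..L} X. 0 < \<delta> y \<and> sdp (convex hull (Tk (fst y) \<inter> cball (snd y) (\<delta> y)))"
    using bchoice[of "Sigma {1..L} X" "\<lambda>y \<delta>. 0 < \<delta> \<and> sdp (convex hull (Tk (fst y) \<inter> cball (snd y) \<delta>))"]
    by blast
  have \<delta>: "0 < \<delta> (k, u) \<and> sdp (convex hull (Tk k \<inter> cball u (\<delta> (k, u))))"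
    if "k \<in> {1..L}" "u \<in> X k" for k u
    using bspec[OF \<delta>0, of "(k, u)"] that by simp
  have "\<exists>U. finite U \<and> U \<subseteq> X k \<and> X k \<subseteq> (\<Union>u\<in>U. ball u (\<delta> (k, u)))" if k: "k \<in> {1..L}" for k
  proof -
    have cover: "X k \<subseteq> (\<Union>u\<in>X k. ball u (\<delta> (k, u)))" using \<delta>[OF k] by auto
    obtain U where "U \<subseteq> X k" "finite U" "X k \<subseteq> (\<Union>u\<in>U. ball u (\<delta> (k, u)))"
      by (fact compactE_image[OF X_compact[OF k] open_ball cover])
    then show ?thesis by blast
  qed
  then have "\<forall>k\<in>{1..L}. \<exists>U. finite U \<and> U \<subseteq> X k \<and> X k \<subseteq> (\<Union>u\<in>U. ball u (\<delta> (k, u)))"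
    by blast
  then obtain U where "\<forall>k\<in>{1..L}. finite (U k) \<and> U k \<subseteq> X k \<and> X k \<subseteq> (\<Union>u\<in>U k. ball u (\<delta> (k, u)))"
    by (rule bchoice[THEN exE])
  then have U: "finite (U k) \<and> U k \<subseteq> X k \<and> X k \<subseteq> (\<Union>u\<in>U k. ball u (\<delta> (k, u)))"
    if "k \<in> {1..L}" for k
    using that by blast
  define I where "I = Sigma {1..L} U"
  define P where "P y = Tk (fst y) \<inter> cball (snd y) (\<delta> y)" for y
  have "finite I" unfolding I_def using U by (intro finite_SigmaI) auto
  have P_compact: "compact (P y)" if "y \<in> I" for y
    unfolding P_def using that Tk_closed unfolding I_def by (intro closed_Int_compact) auto
  have P_T: "P y \<subseteq> T" if "y \<in> I" for y
    using that unfolding P_def I_def T_eq by auto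
  have "sdp (convex hull (\<Union>y\<in>I. P y))"
  proof (rule sdp_convex_hull_UN[OF \<open>finite I\<close>])
    fix y assume "y \<in> I"
    then show "sdp (convex hull (P y))" using \<delta> U unfolding P_def I_def by fastforce
    show "bounded (P y)" by (rule compact_imp_bounded[OF P_compact[OF \<open>y \<in> I\<close>]])
  qed
  moreover have "convex hull (\<Union>y\<in>I. P y) = convex hull T"
  proof
    show "convex hull (\<Union>y\<in>I. P y) \<subseteq> convex hull T"
      using P_T by (intro hull_mono) auto
    show "convex hull T \<subseteq> convex hull (\<Union>y\<in>I. P y)"
    proof (rule convex_hull_subset_if_convex_boundary[OF T_compact])
      have "convex_boundary T \<subseteq> (\<Union>y\<in>I. P y)"
      proof
        fix u assume u: "u \<in> convex_boundary T"
        then have "u \<in> T" unfolding convex_boundary_def by simp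
        then obtain k where k: "k \<in> {1..L}" "u \<in> Tk k" unfolding T_eq by blast
        then obtain w where "w \<in> U k" "u \<in> ball w (\<delta> (k, w))" using U[OF k(1)] u unfolding X_def by blast
        then show "u \<in> (\<Union>y\<in>I. P y)" using k unfolding I_def P_def by (intro UN_I[of "(k, w)"]) auto
      qed
      then show "convex_boundary T \<subseteq> convex hull (\<Union>y\<in>I. P y)"
        using hull_subset[of "\<Union>y\<in>I. P y" convex] by blast
      show "closed (convex hull (\<Union>y\<in>I. P y))"
        by (intro compact_imp_closed compact_convex_hull compact_UN \<open>finite I\<close> P_compact)
    qed simp
  qed
  ultimately show ?thesis using sdp_imp_SDP_representable by metis
qed

end
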